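(* Let $k\in\mathbb N$, $W\in\mathbb R^k$, and let $A_N$ be drawn from the $N\times N$ $(k,W)$-checkerboard ensemble, independently for each $N$. Let $\nu_{A_N}=\frac1N\sum_{\lambda}\delta_{\lambda/\sqrt N}$ be the empirical spectral measure (sum over the eigenvalues $\lambda$ of $A_N$ with multiplicity). Then $\nu_{A_N}$ converges weakly almost surely to the Wigner semicircle measure $\sigma_R$ with radius $R=2\sqrt{1-1/k}$, where $\sigma_R$ has density $\frac{2}{\pi R^2}\sqrt{R^2-x^2}$ for $|x|\le R$ and $0$ otherwise.
   Context: Fix $k\in\mathbb N$ and $W=(w_1,\dots,w_k)\in\mathbb R^k$. The $N\times N$ $(k,W)$-checkerboard ensemble consists of real symmetric matrices $M=(m_{ij})$ with $m_{ij}=w_u$ if $i\equiv j\equiv u \pmod k$ (where $u\in\{1,\dots,k\}$) and $m_{ij}=a_{ij}$ if $i\not\equiv j\pmod k$, where the $a_{ij}=a_{ji}$ ($i<j$) are i.i.d. real random variables with mean $0$, variance $1$ and finite moments of all orders, with the natural product probability measure. *)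

theory Defs
  imports "HOL-Probability.Probability" "Jordan_Normal_Form.Char_Poly"
begin

text \<open>The N x N (k,W)-checkerboard matrix with off-diagonal-class entries a.
  Indices are 0-based (0..N-1); the weight vector W is indexed 0..k-1, so the
  paper's entry w_u with u = ((i-1) mod k)+1 for 1-based i corresponds to W (i mod k).
  The random entry at position (i,j) is a (min i j) (max i j), which makes the
  matrix symmetric.\<close>
definition checkerboard_matrix ::
  "nat \<Rightarrow> (nat \<Rightarrow> real) \<Rightarrow> nat \<Rightarrow> (nat \<Rightarrow> nat \<Rightarrow> real) \<Rightarrow> real mat" where
  "checkerboard_matrix k W N a =
     mat N N (\<lambda>(i, j). if i mod k = j mod k then W (i mod k) else a (min i j) (max i j))"

definition empirical_spectral_measure :: "nat \<Rightarrow> real mat \<Rightarrow> real measure" where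
  "empirical_spectral_measure N A =
     distr (measure_pmf (pmf_of_multiset (image_mset (\<lambda>l. l / sqrt (real N)) (proots (char_poly A)))))
           borel (\<lambda>x. x)"

text \<open>Wigner semicircle measure of radius R (density 2/(pi R^2) sqrt(R^2-x^2) on [-R,R]);
  for the degenerate radius R = 0 it is the Dirac mass at 0 (its weak limit as R -> 0).\<close>
definition semicircle_measure :: "real \<Rightarrow> real measure" where
  "semicircle_measure R =
     (if R = 0 then return borel 0
      else density lborel (\<lambda>x. ennreal (if \<bar>x\<bar> \<le> R then 2 / (pi * R\<^sup>2) * sqrt (R\<^sup>2 - x\<^sup>2) else 0)))"

end

theory Submission
  imports Defs "HOL-Real_Asymp.Real_Asymp"
begin

text \<open>The matrix with all weights \<open>W\<close> set to zero is handled by the moment method. The trace of its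
  \<open>n\<close>-th power is a sum over closed walks avoiding steps between congruent indices. Only walks that use
  no edge exactly once contribute to the expectation, and among those all but the walks traversing
  a tree, each edge twice, have too few vertices to matter. Tree walks are generated by a stack:
  each step either pushes one of about \<open>(1 - 1/k) N\<close> new vertices or pops. This gives the recursion
  of Dyck paths, which the integrals of Chebyshev polynomials against the semicircle law satisfy too.
  The variance of the normalised trace is \<open>O(1/N\<^sup>2)\<close>, since two closed walks sharing an edge visit
  at most \<open>n\<close> vertices if no edge is used exactly once, so the moments converge almost surely.
  Restoring \<open>W\<close> changes the matrix only by a form of rank at most \<open>k\<close>, which moves the distribution
  function of the spectral measure by at most \<open>k/N\<close>.\<close>

subsection \<open>Closed walks and their edges\<close>

text \<open>The weights have to go before moments are taken. A nonzero \<open>W u\<close> makes the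
  quadratic form of order \<open>N\<close> on the normalised indicator of one residue class, hence
  creates an eigenvalue of order \<open>N\<close>; after division by \<open>sqrt N\<close> it would
  make the higher even moments diverge. A distribution function registers how many eigenvalues move,
  not how far, so it tolerates a perturbation of large norm and small rank.

  The radius comes from counting: \<open>1 - 1/k\<close> is the proportion of indices outside the
  residue class of the current vertex, and a tree walk of even length \<open>n\<close> makes
  \<open>n/2\<close> pushes, so the limiting moment carries the factor
  \<open>(1 - 1/k) ^ (n/2)\<close>, which is \<open>(R/2) ^ n\<close>. For \<open>k = 1\<close> no
  push is possible and the limit is the point mass at 0.

  The stack spares a classification of walks up to relabelling of vertices: the number of candidates
  for a push depends on the visited set only up to a bounded error, so the Dyck recursion holds
  directly for the counts, with lower and upper bounds.\<close>

definition edge :: "nat \<Rightarrow> nat \<Rightarrow> nat \<times> nat" where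
  "edge x y = (min x y, max x y)"

fun ledges :: "nat list \<Rightarrow> (nat \<times> nat) list" where
  "ledges (x # y # l) = edge x y # ledges (y # l)"
| "ledges l = []"

lemma edge_commute: "edge x y = edge y x"
  by (simp add: edge_def min.commute max.commute)

lemma edge_eq_iff: "edge x y = edge u v \<longleftrightarrow> (x = u \<and> y = v) \<or> (x = v \<and> y = u)"
  by (auto simp: edge_def min_def max_def)

lemma length_ledges [simp]: "length (ledges l) = length l - 1"
  by (induction l rule: ledges.induct) auto

lemma ledges_append: "ledges (us @ x # vs) = ledges (us @ [x]) @ ledges (x # vs)"
  by (induction us rule: ledges.induct) auto

lemma ledges_rev: "ledges (rev l) = rev (ledges l)"
proof (induction l rule: ledges.induct)
  case (1 x y l)
  have "ledges (rev (x # y # l)) = ledges (rev l @ y # [x])" by simp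
  also have "\<dots> = ledges (rev l @ [y]) @ ledges [y, x]" by (rule ledges_append)
  finally show ?case using 1 by (simp add: edge_commute)
qed auto

definition edge_within :: "nat set \<Rightarrow> nat \<times> nat \<Rightarrow> bool" where
  "edge_within V e \<longleftrightarrow> fst e \<in> V \<and> snd e \<in> V"

lemma edge_within_edge [simp]: "edge_within V (edge x y) \<longleftrightarrow> x \<in> V \<and> y \<in> V"
  by (auto simp: edge_within_def edge_def min_def max_def)

lemma edge_within_mono: "V \<subseteq> V' \<Longrightarrow> edge_within V e \<Longrightarrow> edge_within V' e"
  by (auto simp: edge_within_def)

lemma ledges_within: "e \<in> set (ledges l) \<Longrightarrow> edge_within (set l) e"
proof (induction l rule: ledges.induct)
  case (1 x y l)
  then show ?case using edge_within_mono[of "set (y # l)" "set (x # y # l)" e] by auto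
qed auto

definition allowed :: "nat \<Rightarrow> nat \<times> nat \<Rightarrow> bool" where
  "allowed k e \<longleftrightarrow> fst e mod k \<noteq> snd e mod k"

lemma allowed_edge [simp]: "allowed k (edge x y) \<longleftrightarrow> x mod k \<noteq> y mod k"
  by (auto simp: allowed_def edge_def min_def max_def)

text \<open>Every new vertex is charged to the edge along which the walk first enters it. That edge
  leaves the set visited so far but lies within the enlarged set, so different vertices are charged
  to different edges.\<close>

lemma card_new_vertices_le:
  assumes "c \<in> V"
  shows "card (set l - V) \<le> card {e \<in> set (ledges (c # l)). \<not> edge_within V e}"
  using assms
proof (induction l arbitrary: c V)
  case Nil
  then show ?case by simp
next
  case (Cons x l)
  show ?case
  proof (cases "x \<in> V")
    case True
    have "card (set (x # l) - V) = card (set l - V)"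
      using True by (simp add: insert_Diff_if)
    also have "\<dots> \<le> card {e \<in> set (ledges (x # l)). \<not> edge_within V e}"
      using Cons.IH[OF True] .
    also have "\<dots> \<le> card {e \<in> set (ledges (c # x # l)). \<not> edge_within V e}"
      by (rule card_mono) auto
    finally show ?thesis .
  next
    case False
    let ?S = "{e \<in> set (ledges (x # l)). \<not> edge_within (insert x V) e}"
    have "set (x # l) - V = insert x (set l - insert x V)" using False by auto
    then have "card (set (x # l) - V) = Suc (card (set l - insert x V))" by simp
    also have "\<dots> \<le> Suc (card ?S)"
      using Cons.IH[of x "insert x V"] by simp
    also have "\<dots> = card (insert (edge c x) ?S)"
      using Cons.prems by (subst card_insert_disjoint) auto
    also have "\<dots> \<le> card {e \<in> set (ledges (c # x # l)). \<not> edge_within V e}"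
      using False by (intro card_mono) (auto dest: edge_within_mono[OF subset_insertI])
    finally show ?thesis .
  qed
qed

text \<open>The vertex bound of a connected graph, in a form that survives attaching walks.
  Connectedness enters only through the fact that every attached walk starts in
  \<open>V\<close>.\<close>

definition spanned :: "nat set \<Rightarrow> (nat \<times> nat) set \<Rightarrow> bool" where
  "spanned V E \<longleftrightarrow> finite V \<and> finite E \<and> (\<forall>e\<in>E. edge_within V e) \<and> card V \<le> Suc (card E)"

lemma spanned_extend:
  assumes "spanned V E" "c \<in> V"
  shows "spanned (V \<union> set l) (E \<union> set (ledges (c # l)))"
proof -
  let ?S = "{e \<in> set (ledges (c # l)). \<not> edge_within V e}"
  have fin: "finite V" "finite E" and E: "\<forall>e\<in>E. edge_within V e" and le: "card V \<le> Suc (card E)"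
    using assms by (auto simp: spanned_def)
  have "card (V \<union> set l) = card V + card (set l - V)"
    using fin by (metis Diff_disjoint Un_Diff_cancel card_Un_disjoint finite_Diff List.finite_set)
  also have "\<dots> \<le> Suc (card E) + card ?S"
    using le card_new_vertices_le[OF assms(2), of l] by linarith
  also have "card E + card ?S = card (E \<union> ?S)"
    using E fin by (subst card_Un_disjoint) auto
  then have "Suc (card E) + card ?S = Suc (card (E \<union> ?S))" by simp
  also have "card (E \<union> ?S) \<le> card (E \<union> set (ledges (c # l)))"
    using fin by (intro card_mono) auto
  finally have "card (V \<union> set l) \<le> Suc (card (E \<union> set (ledges (c # l))))" by simp
  moreover have "edge_within (V \<union> set l) e" if "e \<in> set (ledges (c # l))" for e
    using ledges_within[OF that] assms(2) by (auto intro: edge_within_mono[rotated])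
  moreover have "edge_within (V \<union> set l) e" if "e \<in> E" for e
    using E that by (auto intro: edge_within_mono[rotated])
  ultimately show ?thesis using fin unfolding spanned_def by auto
qed

text \<open>The part of \<open>p\<close> before \<open>x\<close> is reversed, so that both halves
  start at \<open>x\<close> and can be attached one after the other.\<close>

lemma spanned_through:
  assumes "spanned V E" "x \<in> V" "x \<in> set p"
  shows "spanned (V \<union> set p) (E \<union> set (ledges p))"
proof -
  obtain p1 p2 where p: "p = p1 @ x # p2" using assms(3) by (meson split_list)
  have 1: "spanned (V \<union> set p2) (E \<union> set (ledges (x # p2)))"
    by (rule spanned_extend[OF assms(1,2)])
  have "spanned (V \<union> set p2 \<union> set (rev p1)) (E \<union> set (ledges (x # p2)) \<union> set (ledges (x # rev p1)))"
    by (rule spanned_extend[OF 1]) (use assms(2) in simp)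
  moreover have "set (ledges (x # rev p1)) = set (ledges (p1 @ [x]))"
    using ledges_rev[of "p1 @ [x]"] by simp
  moreover have "V \<union> set p2 \<union> set (rev p1) = V \<union> set p"
    using assms(2) p by auto
  moreover have "set (ledges p) = set (ledges (p1 @ [x])) \<union> set (ledges (x # p2))"
    unfolding p by (subst ledges_append) simp
  ultimately show ?thesis by (simp add: Un_ac)
qed

lemma card_vertices_le:
  assumes "x \<in> set p" "x \<in> set q"
  shows "card (set p \<union> set q) \<le> Suc (card (set (ledges p) \<union> set (ledges q)))"
proof -
  have "spanned {x} {}" by (simp add: spanned_def)
  then have "spanned ({x} \<union> set p) ({} \<union> set (ledges p))"
    by (rule spanned_through) (use assms in simp_all)
  then have "spanned ({x} \<union> set p \<union> set q) ({} \<union> set (ledges p) \<union> set (ledges q))"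
    by (rule spanned_through) (use assms in simp_all)
  then show ?thesis using assms by (simp add: spanned_def insert_absorb)
qed

section \<open>Cutting a shared edge out of closed walks\<close>

lemma in_ledgesE:
  assumes "e \<in> set (ledges w)"
  obtains xs a b ys where "w = xs @ a # b # ys" "e = edge a b"
  using assms
proof (induction w arbitrary: thesis rule: ledges.induct)
  case (1 x y l)
  show ?case
  proof (cases "e = edge x y")
    case True
    then show ?thesis using 1(2)[of "[]"] by simp
  next
    case False
    then have "e \<in> set (ledges (y # l))" using 1(3) by simp
    then obtain xs a b ys where "y # l = xs @ a # b # ys" "e = edge a b"
      using 1(1) by blast
    then show ?thesis using 1(2)[of "x # xs"] by simp
  qed
qed auto

text \<open>The closed walk is restarted just behind the deleted step and followed around to the
  front of it; closedness makes the remainder a single walk through all vertices. The rotation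
  permutes the edges, hence multisets.\<close>

lemma closed_walk_cut:
  assumes "e \<in> set (ledges w)" "hd w = last w"
  obtains p where "set p = set w" "mset (ledges w) = add_mset e (mset (ledges p))"
proof -
  obtain xs a b ys where w: "w = xs @ a # b # ys" "e = edge a b"
    using assms(1) by (rule in_ledgesE)
  have ledges_w: "ledges w = ledges (xs @ [a]) @ edge a b # ledges (b # ys)"
    using ledges_append[of xs a "b # ys"] w by simp
  show ?thesis
  proof (cases xs)
    case Nil
    have "last (b # ys) = a" using assms(2) w Nil by simp
    then have "a \<in> set (b # ys)" by (metis last_in_set list.distinct(1))
    with that[of "b # ys"] show ?thesis using w ledges_w Nil by auto
  next
    case (Cons r xs')
    have r: "last (b # ys) = r" using assms(2) w Cons by simp
    then obtain zs where zs: "b # ys = zs @ [r]"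
      by (metis append_butlast_last_id list.distinct(1))
    have "ledges (zs @ r # xs' @ [a]) = ledges (zs @ [r]) @ ledges (r # xs' @ [a])"
      by (rule ledges_append)
    then have "ledges (zs @ r # xs' @ [a]) = ledges (b # ys) @ ledges (xs @ [a])"
      using Cons zs by simp
    moreover have "set (zs @ r # xs' @ [a]) = set w"
    proof -
      have "set w = set xs \<union> {a} \<union> set (b # ys)" unfolding w by auto
      also have "set (b # ys) = set zs \<union> {r}" unfolding zs by auto
      finally show ?thesis using Cons by auto
    qed
    ultimately show ?thesis
      using that[of "zs @ r # xs' @ [a]"] ledges_w w by (simp add: union_commute)
  qed
qed

text \<open>Cutting the shared edge out of both closed walks leaves walks through all of their vertices;
  this saves one vertex against the bound \<open>n + 1\<close> given by the number of edges.\<close>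
lemma card_vertices_covariance:
  assumes "hd w = last w" "hd w' = last w'" "length w = Suc n" "length w' = Suc n"
    and e: "e \<in> set (ledges w)" "e \<in> set (ledges w')"
    and twice: "\<And>f. f \<in> set (ledges w @ ledges w') \<Longrightarrow> 2 \<le> count_list (ledges w @ ledges w') f"
  shows "card (set w \<union> set w') \<le> n"
proof -
  obtain p where p: "set p = set w" "mset (ledges w) = add_mset e (mset (ledges p))"
    using e(1) assms(1) by (rule closed_walk_cut)
  obtain q where q: "set q = set w'" "mset (ledges w') = add_mset e (mset (ledges q))"
    using e(2) assms(2) by (rule closed_walk_cut)
  define M where "M = mset (ledges p) + mset (ledges q)"
  have MM: "mset (ledges w @ ledges w') = add_mset e (add_mset e M)"
    using p(2) q(2) by (simp add: M_def)
  have "size (mset (ledges w @ ledges w')) = 2 * n" using assms(3,4) by simp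
  then have size: "size M + 2 = 2 * n" unfolding MM by simp
  have cnt: "count_list (ledges w @ ledges w') f = count (add_mset e (add_mset e M)) f" for f
    unfolding MM[symmetric] by (simp add: count_mset)
  have ge2: "2 \<le> count M f" if "f \<in># M" "f \<noteq> e" for f
  proof -
    have "f \<in># add_mset e (add_mset e M)" using that by simp
    then have "f \<in> set (ledges w @ ledges w')" unfolding MM[symmetric] by simp
    from twice[OF this] that show ?thesis unfolding cnt by simp
  qed
  \<comment> \<open>Both walks have lost one copy of \<open>e\<close>, so \<open>e\<close> is the
    only edge that can be left with multiplicity one; it accounts for the \<open>+ 1\<close>. Since
    \<open>size M = 2 * n - 2\<close>, parity absorbs this and at most \<open>n - 1\<close> distinct
    edges remain.\<close>
  have "2 * card (set_mset M) \<le> size M + 1"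
  proof -
    have "(\<Sum>f\<in>set_mset M. 2) \<le> (\<Sum>f\<in>set_mset M. count M f + (if f = e then 1 else 0))"
    proof (rule sum_mono)
      fix f assume f: "f \<in># M"
      then have "count M f \<ge> 1" by simp
      with ge2[OF f] show "2 \<le> count M f + (if f = e then 1 else 0)" by auto
    qed
    also have "\<dots> = size M + (\<Sum>f\<in>set_mset M. if f = e then 1 else 0)"
      by (simp add: sum.distrib size_multiset_overloaded_eq)
    also have "(\<Sum>f\<in>set_mset M. if f = e then 1 else 0) \<le> (1::nat)"
      by (subst sum.delta) auto
    finally show ?thesis by simp
  qed
  with size have le: "Suc (card (set_mset M)) \<le> n" by linarith
  obtain a where "a \<in> set w" "a \<in> set w'"
    using ledges_within[OF e(1)] ledges_within[OF e(2)] by (auto simp: edge_within_def)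
  then have "card (set p \<union> set q) \<le> Suc (card (set (ledges p) \<union> set (ledges q)))"
    using p q by (intro card_vertices_le) auto
  also have "set (ledges p) \<union> set (ledges q) = set_mset M" by (simp add: M_def)
  finally show ?thesis using le p q by simp
qed

section \<open>Tree walks and Dyck paths\<close>

text \<open>Continuations by \<open>n\<close> steps of a walk that has visited \<open>V\<close> and is at \<open>hd s\<close>, where the stack \<open>s\<close>
  is the tree path back to the root: a step discovers a new vertex or returns to the parent.\<close>
fun dyck :: "nat \<Rightarrow> nat \<Rightarrow> nat \<Rightarrow> nat list \<Rightarrow> nat set \<Rightarrow> nat list set" where
  "dyck k N 0 s V = (if length s = 1 then {[]} else {})"
| "dyck k N (Suc n) s V =
     (\<Union>x\<in>{x. x < N \<and> x \<notin> V \<and> x mod k \<noteq> hd s mod k}. (#) x ` dyck k N n (x # s) (insert x V))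
     \<union> (if 2 \<le> length s then (#) (hd (tl s)) ` dyck k N n (tl s) V else {})"

text \<open>Paths of \<open>n\<close> unit steps from height \<open>h\<close> to 0 that never go
  below 0; at \<open>h = 0\<close> these are the Catalan numbers for even \<open>n\<close>. The
  height stands for the height \<open>length s - 1\<close> of the stack.\<close>

fun dyck_count :: "nat \<Rightarrow> nat \<Rightarrow> nat" where
  "dyck_count 0 h = (if h = 0 then 1 else 0)"
| "dyck_count (Suc n) h = dyck_count n (Suc h) + (if h = 0 then 0 else dyck_count n (h - 1))"

lemma dyck_count_eq_0: "n < h \<Longrightarrow> dyck_count n h = 0"
  by (induction n arbitrary: h) auto

lemma finite_dyck [simp]: "finite (dyck k N n s V)"
  by (induction n arbitrary: s V) auto

text \<open>A continuation that leads from stack height \<open>h\<close> back to the root in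
  \<open>n\<close> steps pushes exactly \<open>(n - h) div 2\<close> times, and each push has
  between \<open>lo\<close> and \<open>hi\<close> choices. \<open>L\<close> bounds every visited set
  that can arise, since a step adds at most one vertex.\<close>

lemma card_dyck_bounds:
  fixes lo hi :: real
  assumes "0 \<le> lo"
    and *: "\<And>V c. finite V \<Longrightarrow> card V \<le> L \<Longrightarrow>
       real (card {x. x < N \<and> x \<notin> V \<and> x mod k \<noteq> c mod k}) \<in> {lo..hi}"
    and "finite V" "card V + n \<le> L" "set s \<subseteq> V" "s \<noteq> []"
  shows "real (card (dyck k N n s V)) \<in>
     {lo ^ ((n - (length s - 1)) div 2) * dyck_count n (length s - 1) ..
      hi ^ ((n - (length s - 1)) div 2) * dyck_count n (length s - 1)}"
  using assms(3-)
proof (induction n arbitrary: s V)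
  case 0
  then show ?case by (cases s) auto
next
  case (Suc n)
  define h where "h = length s - 1"
  have len: "length s = Suc h" using Suc.prems(4) by (cases s) (auto simp: h_def)
  define A where "A = {x. x < N \<and> x \<notin> V \<and> x mod k \<noteq> hd s mod k}"
  have fA: "finite A" by (simp add: A_def)
  have "real (card A) \<in> {lo..hi}" unfolding A_def using Suc.prems by (intro *) auto
  then have A: "lo \<le> card A" "card A \<le> hi" by auto
  have hi: "0 \<le> hi" using A by linarith
  define U where "U = (\<Union>x\<in>A. (#) x ` dyck k N n (x # s) (insert x V))"
  define D where "D = (if 2 \<le> length s then (#) (hd (tl s)) ` dyck k N n (tl s) V else {})"
  have "dyck k N (Suc n) s V = U \<union> D" by (simp add: U_def D_def A_def)
  \<comment> \<open>Pushes enter unvisited vertices, whereas the parent already lies in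
    \<open>V\<close>.\<close>
  moreover have "U \<inter> D = {}"
  proof -
    have "hd (tl s) \<in> V" if "2 \<le> length s"
      using that Suc.prems(3) by (cases s; cases "tl s") auto
    then show ?thesis unfolding U_def D_def A_def by auto
  qed
  ultimately have "card (dyck k N (Suc n) s V) = card U + card D"
    using fA by (simp add: card_Un_disjoint U_def D_def)
  moreover have "card U = (\<Sum>x\<in>A. card (dyck k N n (x # s) (insert x V)))"
    unfolding U_def using fA by (subst card_UN_disjoint) (auto simp: card_image)
  ultimately have card: "real (card (dyck k N (Suc n) s V)) =
      (\<Sum>x\<in>A. real (card (dyck k N n (x # s) (insert x V)))) + card D" by simp
  have up: "real (card (dyck k N n (x # s) (insert x V))) \<in>
     {lo ^ ((n - Suc h) div 2) * dyck_count n (Suc h) ..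
      hi ^ ((n - Suc h) div 2) * dyck_count n (Suc h)}" if "x \<in> A" for x
    using Suc.IH[of "insert x V" "x # s"] Suc.prems that len by (auto simp: A_def)
  \<comment> \<open>One push accounts for one factor. For \<open>n < Suc h\<close> truncated
    subtraction would spoil the exponents, but then the root is out of reach and the count is
    0.\<close>
  have pow: "z * (z ^ ((n - Suc h) div 2) * dyck_count n (Suc h))
     = z ^ ((Suc n - h) div 2) * dyck_count n (Suc h)" for z :: real
  proof (cases "n < Suc h")
    case False
    then have "(Suc n - h) div 2 = Suc ((n - Suc h) div 2)"
      by (simp add: Suc_diff_le div_if)
    then show ?thesis by simp
  qed (simp add: dyck_count_eq_0)
  have U: "(\<Sum>x\<in>A. real (card (dyck k N n (x # s) (insert x V)))) \<in>
    {lo ^ ((Suc n - h) div 2) * dyck_count n (Suc h) .. hi ^ ((Suc n - h) div 2) * dyck_count n (Suc h)}"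
  proof -
    let ?l = "lo ^ ((n - Suc h) div 2) * dyck_count n (Suc h)"
    let ?u = "hi ^ ((n - Suc h) div 2) * dyck_count n (Suc h)"
    have "lo * ?l \<le> card A * ?l" using A assms(1) by (intro mult_right_mono) auto
    also have "\<dots> \<le> (\<Sum>x\<in>A. real (card (dyck k N n (x # s) (insert x V))))"
      using up by (intro sum_bounded_below) auto
    finally have 1: "lo * ?l \<le> \<dots>" .
    have "(\<Sum>x\<in>A. real (card (dyck k N n (x # s) (insert x V)))) \<le> card A * ?u"
      using up by (intro sum_bounded_above) auto
    also have "\<dots> \<le> hi * ?u" using A hi by (intro mult_right_mono) auto
    finally show ?thesis using 1 unfolding pow by simp
  qed
  have D: "real (card D) \<in> {lo ^ ((Suc n - h) div 2) * (if h = 0 then 0 else dyck_count n (h - 1)) ..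
     hi ^ ((Suc n - h) div 2) * (if h = 0 then 0 else dyck_count n (h - 1))}"
  proof (cases "h = 0")
    case True
    then show ?thesis using len by (simp add: D_def)
  next
    case False
    then have "D = (#) (hd (tl s)) ` dyck k N n (tl s) V" using len by (simp add: D_def)
    then have "card D = card (dyck k N n (tl s) V)" by (simp add: card_image)
    moreover have "real (card (dyck k N n (tl s) V)) \<in>
      {lo ^ ((n - (h - 1)) div 2) * dyck_count n (h - 1) ..
       hi ^ ((n - (h - 1)) div 2) * dyck_count n (h - 1)}"
      using Suc.IH[of V "tl s"] Suc.prems len False by (cases s) auto
    ultimately show ?thesis using False by (simp add: Suc_diff_le)
  qed
  show ?case unfolding card h_def[symmetric] using U D by (simp add: ring_distribs)
qed

text \<open>A continuation may only end with the root alone on the stack, so every push is undone.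
  Hence the present stack edges are used once more, and the edges \<open>F\<close> of the newly
  grown part of the tree twice, once in each direction.\<close>

lemma dyck_walk:
  assumes "l \<in> dyck k N n (c # s) V" "set (c # s) \<subseteq> V"
  shows "length l = n" "set l \<subseteq> set (c # s) \<union> {..<N}" "last (c # l) = last (c # s)"
    "\<exists>F. finite F \<and> (\<forall>e\<in>F. \<not> edge_within V e \<and> allowed k e) \<and>
        mset (ledges (c # l)) = mset (ledges (c # s)) + mset_set F + mset_set F"
proof -
  have "length l = n \<and> set l \<subseteq> set (c # s) \<union> {..<N} \<and> last (c # l) = last (c # s) \<and>
    (\<exists>F. finite F \<and> (\<forall>e\<in>F. \<not> edge_within V e \<and> allowed k e) \<and>
        mset (ledges (c # l)) = mset (ledges (c # s)) + mset_set F + mset_set F)"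
    using assms
  proof (induction n arbitrary: l c s V)
    case 0
    then show ?case by (auto split: if_splits intro!: exI[of _ "{}"])
  next
    case (Suc n)
    from Suc.prems(1) consider
        (up) x l' where "x < N" "x \<notin> V" "x mod k \<noteq> c mod k" "l = x # l'"
           "l' \<in> dyck k N n (x # c # s) (insert x V)"
      | (down) p s' l' where "s = p # s'" "l = p # l'" "l' \<in> dyck k N n (p # s') V"
      by (cases s) (auto split: if_splits)
    then show ?case
    proof cases
      case up
      note IH = Suc.IH[OF up(5)]
      have sub: "set (x # c # s) \<subseteq> insert x V" using Suc.prems by auto
      obtain F where F: "finite F"
          "\<forall>e\<in>F. \<not> edge_within (insert x V) e \<and> allowed k e"
          "mset (ledges (x # l')) = mset (ledges (x # c # s)) + mset_set F + mset_set F"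
        using IH[OF sub] by blast
      have c: "c \<in> V" using Suc.prems by simp
      have "edge c x \<notin> F" using F(2) c by auto
      \<comment> \<open>The induction hypothesis counts the edge to \<open>x\<close> once, as a
        stack edge; with the step just made it has two uses and moves into \<open>F\<close>.\<close>
      then have "mset (ledges (c # l)) = mset (ledges (c # s)) +
          mset_set (insert (edge c x) F) + mset_set (insert (edge c x) F)"
        using up F by (simp add: edge_commute)
      moreover have "\<not> edge_within V e" if "e \<in> insert (edge c x) F" for e
        using that up(2) F(2) edge_within_mono[of V "insert x V" e] by auto
      moreover have "allowed k e" if "e \<in> insert (edge c x) F" for e
        using that F(2) up(3) by auto
      moreover have "length l = Suc n" "set l \<subseteq> set (c # s) \<union> {..<N}" "last (c # l) = last (c # s)"
        using IH[OF sub] up(1,4) by auto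
      ultimately show ?thesis using F(1) by (intro conjI exI[of _ "insert (edge c x) F"]) auto
    next
      case down
      note IH = Suc.IH[OF down(3)]
      have sub: "set (p # s') \<subseteq> V" using Suc.prems down by auto
      then show ?thesis using IH[OF sub] down by auto
    qed
  qed
  then show "length l = n" "set l \<subseteq> set (c # s) \<union> {..<N}" "last (c # l) = last (c # s)"
    "\<exists>F. finite F \<and> (\<forall>e\<in>F. \<not> edge_within V e \<and> allowed k e) \<and>
        mset (ledges (c # l)) = mset (ledges (c # s)) + mset_set F + mset_set F" by blast+
qed

lemma edge_not_in_ledges: "c \<notin> set s \<Longrightarrow> edge c x \<notin> set (ledges s)"
  using ledges_within[of "edge c x" s] by auto

lemma distinct_ledges: "distinct s \<Longrightarrow> distinct (ledges s)"
  by (induction s rule: ledges.induct) (use edge_not_in_ledges in auto)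

lemma edge_in_ledges_hd:
  assumes "distinct (c # s)" "edge c x \<in> set (ledges (c # s))"
  obtains s' where "s = x # s'"
proof (cases s)
  case (Cons y s')
  then have "edge c x = edge c y"
    using assms edge_not_in_ledges[of c s x] by auto
  then have "x = y" by (auto simp: edge_eq_iff)
  then show ?thesis using that Cons by blast
qed (use assms in auto)

text \<open>The last hypothesis leaves no slack in counting steps: every stack edge is used exactly once
  more, so a step to a visited vertex can only be the one to the parent.\<close>
lemma dyckI:
  assumes "distinct (c # s)" "set (c # s) \<subseteq> V" "length l = n" "set l \<subseteq> {..<N}"
    and "\<And>e. e \<in> set (ledges (c # l)) \<Longrightarrow> allowed k e"
    and "\<And>e. e \<in> set (ledges (c # l)) \<Longrightarrow> e \<notin> set (ledges (c # s)) \<Longrightarrow> 2 \<le> count_list (ledges (c # l)) e"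
    and "set (ledges (c # s)) \<subseteq> set (ledges (c # l))"
    and "n \<le> length s + 2 * card (set l - V)"
  shows "l \<in> dyck k N n (c # s) V"
  using assms
proof (induction n arbitrary: l c s V)
  case 0
  then show ?case by (cases s) auto
next
  case (Suc n)
  note dist = Suc.prems(1) and V = Suc.prems(2) and allow = Suc.prems(5) and twice = Suc.prems(6)
    and stack = Suc.prems(7) and many = Suc.prems(8)
  obtain x l' where l: "l = x # l'" "length l' = n" using Suc.prems(3) by (cases l) auto
  let ?L = "ledges (c # l)"
  have L: "?L = edge c x # ledges (x # l')" using l by simp
  have x: "x < N" "x mod k \<noteq> c mod k" using Suc.prems(4) allow[of "edge c x"] l by auto
  show ?case
  proof (cases "x \<in> V")
    case False
    have new: "edge c x \<notin> set (ledges (c # s))"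
      using ledges_within[of "edge c x" "c # s"] V False by auto
    have "set l - V = insert x (set l' - insert x V)" using l False by auto
    then have "card (set l - V) = Suc (card (set l' - insert x V))" by simp
    \<comment> \<open>The discovering step does not use a stack edge, so its edge must recur later,
      as is required of an edge of the extended stack.\<close>
    moreover have "edge c x \<in> set (ledges (x # l'))"
      using twice[of "edge c x"] new L
      by (cases "edge c x \<in> set (ledges (x # l'))") auto
    moreover have "set (ledges (c # s)) \<subseteq> set (ledges (x # l'))"
      using stack new L by auto
    moreover have "2 \<le> count_list (ledges (x # l')) e"
      if "e \<in> set (ledges (x # l'))" "e \<notin> set (ledges (x # c # s))" for e
      using twice[of e] that L by (auto simp: edge_commute split: if_splits)
    ultimately have "l' \<in> dyck k N n (x # c # s) (insert x V)"
      using Suc.prems l False by (intro Suc.IH) (auto simp: edge_commute)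
    then show ?thesis using l x False by auto
  next
    case True
    let ?O = "{e \<in> set ?L. \<not> edge_within V e}"
    let ?S = "set (ledges (c # s))"
    have c: "c \<in> V" using V by simp
    \<comment> \<open>A second use would be one step too many: each stack edge takes at least one
      step, each edge leaving \<open>V\<close> at least two, and \<open>edge c x\<close>, which lies
      within \<open>V\<close>, would take one beyond these. The hypothesis \<open>many\<close>
      allows no surplus.\<close>
    have once: "count_list ?L (edge c x) \<le> 1"
    proof (rule ccontr)
      assume "\<not> ?thesis"
      then have *: "2 \<le> count_list ?L (edge c x)" by simp
      have S_within: "edge_within V e" if "e \<in> ?S" for e
        using ledges_within[OF that] V by (blast intro: edge_within_mono)
      have "card ?S = length s"
        using distinct_card[OF distinct_ledges[OF dist]] by simp
      moreover have "card (set l - V) \<le> card ?O" by (rule card_new_vertices_le[OF c])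
      moreover have "card ?S + 2 * card ?O + 1 =
          (\<Sum>e\<in>set ?L. (if e \<in> ?S then 1 else 0) + 2 * (if e \<in> ?O then 1 else 0) + (if e = edge c x then 1 else 0))"
      proof -
        have "(\<Sum>e\<in>set ?L. if e \<in> ?S then 1 else 0) = card ?S"
          using stack by (simp add: sum.If_cases Int_absorb1)
        moreover have "(\<Sum>e\<in>set ?L. if e \<in> ?O then 1 else 0) = card ?O"
          by (simp add: sum.If_cases Int_def)
        moreover have "(\<Sum>e\<in>set ?L. if e = edge c x then 1 else 0) = (1::nat)"
          using L by simp
        ultimately show ?thesis by (simp only: sum.distrib sum_distrib_left[symmetric])
      qed
      moreover have "\<dots> \<le> (\<Sum>e\<in>set ?L. count_list ?L e)"
      proof (rule sum_mono)
        fix e assume e: "e \<in> set ?L"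
        then have 1: "1 \<le> count_list ?L e" by (metis count_list_0_iff less_one not_le)
        have 2: "2 \<le> count_list ?L e" if "e \<notin> ?S" using twice[OF e that] .
        have 3: "e \<notin> ?O" if "e \<in> ?S \<or> e = edge c x"
        proof -
          have "edge_within V (edge c x)" using c True by simp
          then have "edge_within V e" using that S_within by metis
          then show ?thesis by simp
        qed
        show "(if e \<in> ?S then 1 else 0) + 2 * (if e \<in> ?O then 1 else 0) + (if e = edge c x then 1 else 0)
           \<le> count_list ?L e"
          using 1 2 3 * by (cases "e \<in> ?S"; cases "e = edge c x"; cases "e \<in> ?O") auto
      qed
      moreover have "(\<Sum>e\<in>set ?L. count_list ?L e) = Suc n"
        using sum_count_set[of ?L "set ?L"] Suc.prems(3) by simp
      ultimately show False using many by linarith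
    qed
    \<comment> \<open>An edge used only once must be a stack edge. As the stack is a path without
      repetitions, its only edge at \<open>c\<close> leads to the parent, so the step is a
      pop.\<close>
    have "edge c x \<in> ?S" using once twice[of "edge c x"] L by fastforce
    then obtain s' where s: "s = x # s'" using dist edge_in_ledges_hd by blast
    have notin: "edge c x \<notin> set (ledges (x # l'))"
      using once L by (simp add: count_list_0_iff)
    have "edge c x \<notin> set (ledges (x # s'))"
      using dist s edge_not_in_ledges[of c "x # s'" x] by auto
    then have "set (ledges (x # s')) \<subseteq> set (ledges (x # l'))"
      using stack s L by auto
    moreover have "2 \<le> count_list (ledges (x # l')) e"
      if "e \<in> set (ledges (x # l'))" "e \<notin> set (ledges (x # s'))" for e
    proof -
      have "e \<noteq> edge c x" using that notin by auto
      then show ?thesis using twice[of e] that L s by (auto split: if_splits)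
    qed
    moreover have "set l - V = set l' - V" using l True by auto
    ultimately have "l' \<in> dyck k N n (x # s') V"
      using Suc.prems l s by (intro Suc.IH) auto
    then show ?thesis using l s by auto
  qed
qed

text \<open>Such a list is a word over \<open>q\<close> positions together with the values stored at
  these positions.\<close>

lemma card_lists_few_elements:
  assumes "0 < N"
  shows "card {w. length w = n \<and> set w \<subseteq> {..<N} \<and> card (set w) \<le> q} \<le> N ^ q * q ^ n"
proof -
  let ?U = "{u. set u \<subseteq> {..<N} \<and> length u = q}" and ?V = "{v. set v \<subseteq> {..<q} \<and> length v = n}"
  let ?f = "\<lambda>(u, v). map ((!) u) v"
  have "{w. length w = n \<and> set w \<subseteq> {..<N} \<and> card (set w) \<le> q} \<subseteq> ?f ` (?U \<times> ?V)"
  proof clarify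
    fix w assume w: "set w \<subseteq> {..<N}" "card (set w) \<le> q" "n = length w"
    \<comment> \<open>Padding with 0 fixes the number of stored values at \<open>q\<close>; 0 is an
      admissible value because \<open>N\<close> is positive.\<close>
    define u where "u = sorted_list_of_set (set w) @ replicate (q - card (set w)) 0"
    have u: "length u = q" "set u \<subseteq> {..<N}" "set w \<subseteq> set u"
      using w assms by (auto simp: u_def)
    have "\<exists>i<q. u ! i = y" if "y \<in> set w" for y
      using u that by (metis in_set_conv_nth subsetD)
    then obtain g where g: "\<And>y. y \<in> set w \<Longrightarrow> g y < q \<and> u ! g y = y" by metis
    have "w = ?f (u, map g w)" using g by (simp add: map_idI)
    moreover have "(u, map g w) \<in> ?U \<times> ?V" using u g w by auto
    ultimately show "w \<in> ?f ` (?U \<times> {v. set v \<subseteq> {..<q} \<and> length v = length w})"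
      using w by blast
  qed
  then have "card {w. length w = n \<and> set w \<subseteq> {..<N} \<and> card (set w) \<le> q} \<le> card (?f ` (?U \<times> ?V))"
    by (intro card_mono finite_imageI finite_cartesian_product finite_lists_length_eq) auto
  also have "\<dots> \<le> card (?U \<times> ?V)"
    by (intro card_image_le finite_cartesian_product finite_lists_length_eq) auto
  also have "\<dots> = N ^ q * q ^ n"
    by (simp add: card_cartesian_product card_lists_length_eq)
  finally show ?thesis .
qed

subsection \<open>Weights of walks\<close>

definition walks :: "nat \<Rightarrow> nat \<Rightarrow> nat \<Rightarrow> nat list set" where
  "walks k N n = {w. length w = Suc n \<and> set w \<subseteq> {..<N} \<and> hd w = last w \<and> (\<forall>e\<in>set (ledges w). allowed k e)}"

definition dyck_walks :: "nat \<Rightarrow> nat \<Rightarrow> nat \<Rightarrow> nat list set" where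
  "dyck_walks k N n = (\<Union>r<N. (#) r ` dyck k N n [r] {r})"

text \<open>The expectation of the product of the entries along \<open>es\<close> when entries at
  different edges are independent with moments \<open>\<mu>\<close>: equal edges combine to a power.
  In this form the estimates below are pure counting.\<close>

definition weight :: "(nat \<Rightarrow> real) \<Rightarrow> (nat \<times> nat) list \<Rightarrow> real" where
  "weight \<mu> es = (\<Prod>e\<in>set es. \<mu> (count_list es e))"

lemma finite_walks [simp]: "finite (walks k N n)"
  by (rule finite_subset[OF _ finite_lists_length_eq[of "{..<N}" "Suc n"]]) (auto simp: walks_def)


lemma weight_eq_0:
  assumes "e \<in> set es" "count_list es e \<le> 1" "\<mu> 1 = 0"
  shows "weight \<mu> es = 0"
proof -
  have "count_list es e \<noteq> 0" using assms(1) by (simp add: count_list_0_iff)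
  then have "count_list es e = 1" using assms(2) by linarith
  then have "\<mu> (count_list es e) = 0" using assms(3) by simp
  then show ?thesis using assms(1) unfolding weight_def by (intro prod_zero) auto
qed

lemma weight_append:
  assumes "set es \<inter> set fs = {}"
  shows "weight \<mu> (es @ fs) = weight \<mu> es * weight \<mu> fs"
proof -
  have "(\<Prod>e\<in>set es. \<mu> (count_list (es @ fs) e)) = weight \<mu> es"
    unfolding weight_def
  proof (rule prod.cong)
    fix e assume "e \<in> set es"
    then have "e \<notin> set fs" using assms by blast
    then show "\<mu> (count_list (es @ fs) e) = \<mu> (count_list es e)" by simp
  qed simp
  moreover have "(\<Prod>e\<in>set fs. \<mu> (count_list (es @ fs) e)) = weight \<mu> fs"
    unfolding weight_def
  proof (rule prod.cong)
    fix e assume "e \<in> set fs"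
    then have "e \<notin> set es" using assms by blast
    then show "\<mu> (count_list (es @ fs) e) = \<mu> (count_list fs e)" by simp
  qed simp
  ultimately show ?thesis
    using assms unfolding weight_def by (simp add: prod.union_disjoint)
qed

text \<open>The leading 1 keeps the base at least 1, so the exponent \<open>n\<close> dominates any
  smaller number of distinct edges.\<close>

definition moment_bound :: "(nat \<Rightarrow> real) \<Rightarrow> nat \<Rightarrow> real" where
  "moment_bound \<mu> n = (1 + (\<Sum>m\<le>n. \<bar>\<mu> m\<bar>)) ^ n"

lemma abs_weight_le:
  assumes "length es \<le> n"
  shows "\<bar>weight \<mu> es\<bar> \<le> moment_bound \<mu> n"
proof -
  let ?B = "1 + (\<Sum>m\<le>n. \<bar>\<mu> m\<bar>)"
  have B: "1 \<le> ?B" by (simp add: sum_nonneg)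
  have "\<bar>weight \<mu> es\<bar> = (\<Prod>e\<in>set es. \<bar>\<mu> (count_list es e)\<bar>)"
    by (simp add: weight_def abs_prod)
  also have "\<dots> \<le> (\<Prod>e\<in>set es. ?B)"
  proof (rule prod_mono)
    fix e
    have "count_list es e \<le> n" using count_le_length[of es e] assms by linarith
    then have "\<bar>\<mu> (count_list es e)\<bar> \<le> (\<Sum>m\<le>n. \<bar>\<mu> m\<bar>)"
      by (intro member_le_sum[where f = "\<lambda>m. \<bar>\<mu> m\<bar>"]) auto
    then show "0 \<le> \<bar>\<mu> (count_list es e)\<bar> \<and> \<bar>\<mu> (count_list es e)\<bar> \<le> ?B" by auto
  qed
  also have "\<dots> = ?B ^ card (set es)" by simp
  also have "\<dots> \<le> ?B ^ n"
    using card_length[of es] assms B by (intro power_increasing) auto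
  finally show ?thesis by (simp add: moment_bound_def)
qed

lemma moment_bound_nonneg: "0 \<le> moment_bound \<mu> n"
  by (simp add: moment_bound_def sum_nonneg)

lemma dyck_walks_subset: "dyck_walks k N n \<subseteq> walks k N n"
proof
  fix w assume "w \<in> dyck_walks k N n"
  then obtain r l where w: "w = r # l" "r < N" "l \<in> dyck k N n [r] {r}"
    by (auto simp: dyck_walks_def)
  note * = dyck_walk[OF w(3)]
  obtain F where F: "finite F" "\<forall>e\<in>F. \<not> edge_within {r} e \<and> allowed k e"
      "mset (ledges (r # l)) = mset (ledges [r]) + mset_set F + mset_set F"
    using *(4) by auto
  have "set (ledges w) = F"
    using arg_cong[OF F(3), of set_mset] F(1) w(1) by simp
  then show "w \<in> walks k N n" using * F w by (auto simp: walks_def)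
qed

lemma weight_dyck_walks:
  assumes "w \<in> dyck_walks k N n" "\<mu> 2 = 1"
  shows "weight \<mu> (ledges w) = 1"
proof -
  obtain r l where w: "w = r # l" "l \<in> dyck k N n [r] {r}"
    using assms by (auto simp: dyck_walks_def)
  obtain F where F: "finite F" "mset (ledges w) = mset (ledges [r]) + mset_set F + mset_set F"
    using dyck_walk(4)[OF w(2)] w(1) by auto
  have set: "set (ledges w) = F"
    using arg_cong[OF F(2), of set_mset] F(1) by simp
  have "count_list (ledges w) e = 2" if "e \<in> F" for e
    using arg_cong[OF F(2), of "\<lambda>M. count M e"] that F(1) by (simp add: count_mset)
  then show ?thesis using assms(2) by (simp add: weight_def set)
qed

text \<open>Since \<open>\<mu> 1 = 0\<close>, a nonzero weight excludes edges used once. With more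
  than \<open>(n + 1) div 2\<close> vertices the counting hypothesis of \<open>dyckI\<close> would
  hold for the stack consisting of the root, and the walk would be a tree walk.\<close>

lemma walks_few_vertices:
  assumes "w \<in> walks k N n" "w \<notin> dyck_walks k N n" "weight \<mu> (ledges w) \<noteq> 0" "\<mu> 1 = 0"
  shows "card (set w) \<le> (n + 1) div 2"
proof (rule ccontr)
  assume many: "\<not> ?thesis"
  obtain r l where w: "w = r # l" using assms(1) by (cases w) (auto simp: walks_def)
  have "set w = insert r (set l - {r})" using w by auto
  then have "card (set w) = Suc (card (set l - {r}))"
    by (simp only: card_insert_disjoint[OF finite_Diff[OF List.finite_set]] Diff_iff singleton_iff simp_thms)
  then have "n \<le> 2 * card (set l - {r})" using many by presburger
  moreover have "2 \<le> count_list (ledges (r # l)) e" if "e \<in> set (ledges (r # l))" for e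
  proof (rule ccontr)
    assume "\<not> ?thesis"
    then have "count_list (ledges (r # l)) e \<le> 1" by simp
    then show False using weight_eq_0[OF that] assms(3,4) w by simp
  qed
  ultimately have "l \<in> dyck k N n [r] {r}"
    using assms(1) w by (intro dyckI) (simp_all add: walks_def)
  moreover have "r < N" using assms(1) w by (simp add: walks_def)
  ultimately show False using assms(2) w by (auto simp: dyck_walks_def)
qed

text \<open>Against the normalisation \<open>N * sqrt N ^ n\<close> this error is of order
  \<open>1 / sqrt N\<close> for odd \<open>n\<close> and \<open>1 / N\<close> for even
  \<open>n\<close>.\<close>

lemma sum_weight_approx:
  assumes "\<mu> 1 = 0" "\<mu> 2 = 1" "0 < N"
  shows "\<bar>(\<Sum>w\<in>walks k N n. weight \<mu> (ledges w)) - card (dyck_walks k N n)\<bar>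
     \<le> moment_bound \<mu> n * (real N ^ ((n + 1) div 2) * real ((n + 1) div 2) ^ Suc n)"
proof -
  let ?q = "(n + 1) div 2"
  let ?R = "{w \<in> walks k N n - dyck_walks k N n. weight \<mu> (ledges w) \<noteq> 0}"
  have fin: "finite (dyck_walks k N n)"
    using dyck_walks_subset finite_walks by (rule finite_subset)
  have "(\<Sum>w\<in>walks k N n. weight \<mu> (ledges w)) =
     (\<Sum>w\<in>walks k N n - dyck_walks k N n. weight \<mu> (ledges w)) + (\<Sum>w\<in>dyck_walks k N n. weight \<mu> (ledges w))"
    using dyck_walks_subset by (intro sum.subset_diff) auto
  also have "(\<Sum>w\<in>dyck_walks k N n. weight \<mu> (ledges w)) = card (dyck_walks k N n)"
    using assms by (simp add: weight_dyck_walks)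
  also have "(\<Sum>w\<in>walks k N n - dyck_walks k N n. weight \<mu> (ledges w)) = (\<Sum>w\<in>?R. weight \<mu> (ledges w))"
    by (rule sum.mono_neutral_right) auto
  finally have "\<bar>(\<Sum>w\<in>walks k N n. weight \<mu> (ledges w)) - card (dyck_walks k N n)\<bar>
      = \<bar>\<Sum>w\<in>?R. weight \<mu> (ledges w)\<bar>" by simp
  also have "\<dots> \<le> (\<Sum>w\<in>?R. \<bar>weight \<mu> (ledges w)\<bar>)" by (rule sum_abs)
  also have "\<dots> \<le> card ?R * moment_bound \<mu> n"
    by (intro sum_bounded_above abs_weight_le) (auto simp: walks_def)
  also have "card ?R \<le> card {w. length w = Suc n \<and> set w \<subseteq> {..<N} \<and> card (set w) \<le> ?q}"
  proof (rule card_mono)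
    show "finite {w. length w = Suc n \<and> set w \<subseteq> {..<N} \<and> card (set w) \<le> ?q}"
      by (rule finite_subset[OF _ finite_lists_length_eq[of "{..<N}" "Suc n"]]) auto
    show "?R \<subseteq> {w. length w = Suc n \<and> set w \<subseteq> {..<N} \<and> card (set w) \<le> ?q}"
    proof
      fix w assume w: "w \<in> ?R"
      then have "card (set w) \<le> ?q"
        by (intro walks_few_vertices[of w k N n \<mu>] assms) auto
      then show "w \<in> {w. length w = Suc n \<and> set w \<subseteq> {..<N} \<and> card (set w) \<le> ?q}"
        using w by (simp add: walks_def)
    qed
  qed
  then have "card ?R \<le> N ^ ?q * ?q ^ Suc n"
    using card_lists_few_elements[OF assms(3), of "Suc n" ?q] by linarith
  then have "real (card ?R) \<le> real N ^ ?q * real ?q ^ Suc n"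
    unfolding of_nat_power[symmetric] of_nat_mult[symmetric] of_nat_le_iff .
  then have "card ?R * moment_bound \<mu> n \<le> (real N ^ ?q * real ?q ^ Suc n) * moment_bound \<mu> n"
    using moment_bound_nonneg by (rule mult_right_mono)
  finally show ?thesis by (simp add: mult.commute)
qed

text \<open>Without a common edge the weight is multiplicative. An edge of total multiplicity one
  makes the joint weight vanish, and also the weight of the walk that contains it, so both sides
  would be 0.\<close>

lemma weight_covariance_few_vertices:
  assumes "w \<in> walks k N n" "w' \<in> walks k N n" "\<mu> 1 = 0"
    and "weight \<mu> (ledges w @ ledges w') \<noteq> weight \<mu> (ledges w) * weight \<mu> (ledges w')"
  shows "card (set w \<union> set w') \<le> n"
proof -
  have "set (ledges w) \<inter> set (ledges w') \<noteq> {}"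
    using weight_append[of "ledges w" "ledges w'" \<mu>] assms(4) by argo
  then obtain e where e: "e \<in> set (ledges w)" "e \<in> set (ledges w')" by blast
  have "2 \<le> count_list (ledges w @ ledges w') f" if f: "f \<in> set (ledges w @ ledges w')" for f
  proof (rule ccontr)
    assume "\<not> ?thesis"
    then have 1: "count_list (ledges w @ ledges w') f \<le> 1" by simp
    have "weight \<mu> (ledges w @ ledges w') = 0" using f 1 assms(3) by (rule weight_eq_0)
    moreover have "weight \<mu> (ledges w) = 0 \<or> weight \<mu> (ledges w') = 0"
    proof (cases "f \<in> set (ledges w)")
      case True
      then show ?thesis using 1 assms(3) by (intro disjI1 weight_eq_0[of f]) simp_all
    next
      case False
      then show ?thesis using f 1 assms(3) by (intro disjI2 weight_eq_0[of f]) simp_all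
    qed
    ultimately show False using assms(4) by simp
  qed
  with assms(1,2) e show ?thesis
    by (intro card_vertices_covariance[of w w' n e]) (simp_all add: walks_def)
qed

lemma sum_weight_covariance_le:
  assumes "\<mu> 1 = 0" "0 < N"
  shows "(\<Sum>(w, w')\<in>walks k N n \<times> walks k N n.
      weight \<mu> (ledges w @ ledges w') - weight \<mu> (ledges w) * weight \<mu> (ledges w'))
    \<le> (moment_bound \<mu> (2 * n) + (moment_bound \<mu> n)\<^sup>2) * (real N ^ n * real n ^ (2 * Suc n))"
proof -
  define c where "c = (\<lambda>(w, w').
    weight \<mu> (ledges w @ ledges w') - weight \<mu> (ledges w) * weight \<mu> (ledges w'))"
  let ?B = "moment_bound \<mu> (2 * n) + (moment_bound \<mu> n)\<^sup>2"
  let ?P = "{p \<in> walks k N n \<times> walks k N n. c p \<noteq> 0}"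
  let ?Q = "{w. length w = 2 * Suc n \<and> set w \<subseteq> {..<N} \<and> card (set w) \<le> n}"
  have "(\<Sum>p\<in>walks k N n \<times> walks k N n. c p) = (\<Sum>p\<in>?P. c p)"
    by (rule sum.mono_neutral_right) auto
  also have "\<dots> \<le> card ?P * ?B"
  proof (rule sum_bounded_above)
    fix p assume "p \<in> ?P"
    then obtain w w' where p: "p = (w, w')" and w: "w \<in> walks k N n" "w' \<in> walks k N n" by auto
    have "\<bar>weight \<mu> (ledges w @ ledges w')\<bar> \<le> moment_bound \<mu> (2 * n)"
      using w by (intro abs_weight_le) (simp add: walks_def)
    moreover have "\<bar>weight \<mu> (ledges w) * weight \<mu> (ledges w')\<bar> \<le> (moment_bound \<mu> n)\<^sup>2"
      unfolding abs_mult power2_eq_square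
      using w by (intro mult_mono abs_weight_le moment_bound_nonneg) (auto simp: walks_def)
    ultimately show "c p \<le> ?B" unfolding p c_def by auto
  qed
  also have "card ?P \<le> card ?Q"
  proof (rule card_inj_on_le)
    \<comment> \<open>All walks have length \<open>Suc n\<close>, so the concatenation determines
      both. It need not be a walk itself; what is counted is its distinct entries.\<close>
    show "inj_on (\<lambda>(w, w'). w @ w') ?P"
      by (auto simp: inj_on_def walks_def)
    show "(\<lambda>(w, w'). w @ w') ` ?P \<subseteq> ?Q"
    proof clarify
      fix w w' assume w: "w \<in> walks k N n" "w' \<in> walks k N n" and "c (w, w') \<noteq> 0"
      then have "card (set w \<union> set w') \<le> n"
        by (intro weight_covariance_few_vertices[of w k N n w' \<mu>] assms) (auto simp: c_def)
      then show "length (w @ w') = 2 * Suc n \<and> set (w @ w') \<subseteq> {..<N} \<and> card (set (w @ w')) \<le> n"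
        using w by (simp add: walks_def)
    qed
    show "finite ?Q"
      by (rule finite_subset[OF _ finite_lists_length_eq[of "{..<N}" "2 * Suc n"]]) auto
  qed
  then have "card ?P \<le> N ^ n * n ^ (2 * Suc n)"
    using card_lists_few_elements[OF assms(2), of "2 * Suc n" n] by linarith
  then have "real (card ?P) \<le> real N ^ n * real n ^ (2 * Suc n)"
    unfolding of_nat_power[symmetric] of_nat_mult[symmetric] of_nat_le_iff .
  then have "card ?P * ?B \<le> (real N ^ n * real n ^ (2 * Suc n)) * ?B"
    using moment_bound_nonneg[of \<mu> "2 * n"] by (intro mult_right_mono) auto
  finally show ?thesis by (simp add: c_def mult.commute)
qed

section \<open>Asymptotic number of tree walks\<close>

lemma card_residue_class:
  assumes "1 \<le> k"
  shows "real (card {x. x < N \<and> x mod k = c mod k}) \<in> {real N / k - 1 .. real N / k + 1}"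
proof -
  have k: "c mod k < k" using assms by simp
  have "(\<lambda>i. i * k + c mod k) ` {..<N div k} \<subseteq> {x. x < N \<and> x mod k = c mod k}"
  proof clarsimp
    fix i assume "i < N div k"
    then have "Suc i * k \<le> N div k * k" by (intro mult_le_mono1) simp
    also have "\<dots> \<le> N" by simp
    finally show "i * k + c mod k < N" using k by simp
  qed
  then have "card ((\<lambda>i. i * k + c mod k) ` {..<N div k}) \<le> card {x. x < N \<and> x mod k = c mod k}"
    by (intro card_mono) auto
  moreover have "inj_on (\<lambda>i. i * k + c mod k) A" for A using assms by (auto simp: inj_on_def)
  ultimately have lo: "N div k \<le> card {x. x < N \<and> x mod k = c mod k}" by (simp add: card_image)
  have "{x. x < N \<and> x mod k = c mod k} \<subseteq> (\<lambda>i. i * k + c mod k) ` {..N div k}"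
  proof clarsimp
    fix x assume x: "x < N" "x mod k = c mod k"
    then have "x = x div k * k + c mod k" by (metis div_mult_mod_eq)
    moreover have "x div k \<in> {..N div k}" using x by (simp add: div_le_mono)
    ultimately show "x \<in> (\<lambda>i. i * k + c mod k) ` {..N div k}" by blast
  qed
  then have "card {x. x < N \<and> x mod k = c mod k} \<le> card ((\<lambda>i. i * k + c mod k) ` {..N div k})"
    by (intro card_mono) auto
  also have "\<dots> \<le> N div k + 1" using card_image_le[of "{..N div k}"] by simp
  finally have hi: "card {x. x < N \<and> x mod k = c mod k} \<le> N div k + 1" .
  have "real N / k - 1 \<le> N div k" "N div k \<le> real N / k"
  proof -
    have "real N = real k * real (N div k) + real (N mod k)"
      by (metis mult_div_mod_eq of_nat_add of_nat_mult)
    moreover have "real (N mod k) < real k" using assms by simp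
    ultimately show "real N / k - 1 \<le> N div k" using assms by (simp add: field_simps)
    show "N div k \<le> real N / k" by (rule of_nat_div_le_of_nat)
  qed
  then show ?thesis using lo hi by auto
qed

lemma card_dyck_walks_bounds:
  assumes "1 \<le> k"
  defines "\<alpha> \<equiv> 1 - 1 / real k"
  shows "real (card (dyck_walks k N n)) \<in>
    {real N * (max 0 (\<alpha> * N - real (n + 2)) ^ (n div 2) * dyck_count n 0) ..
     real N * ((\<alpha> * N + 1) ^ (n div 2) * dyck_count n 0)}"
proof -
  \<comment> \<open>The loss \<open>n + 2\<close> consists of at most \<open>n + 1\<close> visited
    vertices and 1 for a residue class larger than \<open>N / k\<close>. The maximum keeps the lower
    bound nonnegative for small \<open>N\<close>.\<close>
  let ?lo = "max 0 (\<alpha> * N - real (n + 2))" and ?hi = "\<alpha> * N + 1"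
  have *: "real (card {x. x < N \<and> x \<notin> V \<and> x mod k \<noteq> c mod k}) \<in> {?lo..?hi}"
    if "finite V" "card V \<le> Suc n" for V c
  proof -
    let ?C = "{x. x < N \<and> x mod k = c mod k}"
    have eq: "{x. x < N \<and> x \<notin> V \<and> x mod k \<noteq> c mod k} = {..<N} - ?C - V" by auto
    have C: "card ({..<N} - ?C) = N - card ?C"
      by (subst card_Diff_subset) auto
    have CN: "card ?C \<le> N" using card_mono[of "{..<N}" ?C] by auto
    have "card ({..<N} - ?C - V) \<ge> card ({..<N} - ?C) - card V"
      using that by (intro diff_card_le_card_Diff) auto
    moreover have "card ({..<N} - ?C - V) \<le> card ({..<N} - ?C)" by (intro card_mono) auto
    ultimately have "real N - card ?C - card V \<le> card ({..<N} - ?C - V)"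
       "card ({..<N} - ?C - V) \<le> real N - card ?C"
      using C CN by linarith+
    moreover have "\<alpha> * N = real N - real N / k" by (simp add: \<alpha>_def algebra_simps)
    moreover have "real (card V) \<le> Suc n" using that by simp
    ultimately show ?thesis
      using card_residue_class[OF assms(1), of N c] unfolding eq by auto
  qed
  have r: "real (card (dyck k N n [r] {r})) \<in>
     {?lo ^ (n div 2) * dyck_count n 0 .. ?hi ^ (n div 2) * dyck_count n 0}" for r
    using card_dyck_bounds[of ?lo "Suc n" N k ?hi "{r}" n "[r]", OF _ *] by simp
  have "card (dyck_walks k N n) = (\<Sum>r<N. card (dyck k N n [r] {r}))"
    unfolding dyck_walks_def by (subst card_UN_disjoint) (auto simp: card_image)
  then have "real (card (dyck_walks k N n)) = (\<Sum>r<N. real (card (dyck k N n [r] {r})))" by simp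
  moreover have "\<dots> \<le> real (card {..<N}) * (?hi ^ (n div 2) * dyck_count n 0)"
    using r by (intro sum_bounded_above) auto
  moreover have "(\<Sum>r<N. real (card (dyck k N n [r] {r}))) \<ge> real (card {..<N}) * (?lo ^ (n div 2) * dyck_count n 0)"
    using r by (intro sum_bounded_below) auto
  ultimately show ?thesis by simp
qed

lemma dyck_count_odd: "odd (n + h) \<Longrightarrow> dyck_count n h = 0"
  by (induction n arbitrary: h) (auto simp: odd_pos)

lemma card_dyck_walks_limit:
  assumes "1 \<le> k"
  shows "(\<lambda>N. card (dyck_walks k N n) / (real N * sqrt N ^ n))
     \<longlonglongrightarrow> (1 - 1 / real k) ^ (n div 2) * dyck_count n 0"
proof (cases "even n")
  case False
  then have "dyck_count n 0 = 0" by (intro dyck_count_odd) simp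
  then have "card (dyck_walks k N n) = 0" for N
    using card_dyck_walks_bounds[OF assms, of N n] by simp
  then show ?thesis using \<open>dyck_count n 0 = 0\<close> by simp
next
  case True
  define \<alpha> where "\<alpha> = 1 - 1 / real k"
  let ?m = "n div 2"
  have sq: "sqrt N ^ n = real N ^ ?m" for N
    using True by (metis even_two_times_div_two of_nat_0_le_iff power_mult real_sqrt_pow2)
  have lo: "(\<lambda>N. (max 0 (\<alpha> * N - real (n + 2)) / real N) ^ ?m * dyck_count n 0) \<longlonglongrightarrow> (max 0 \<alpha>) ^ ?m * dyck_count n 0"
  proof (intro tendsto_intros)
    have "(\<lambda>N. max 0 (\<alpha> - real (n + 2) / real N)) \<longlonglongrightarrow> max 0 (\<alpha> - 0)"
      by (intro tendsto_intros lim_const_over_n)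
    moreover have "\<forall>\<^sub>F N in sequentially. max 0 (\<alpha> - real (n + 2) / real N) = max 0 (\<alpha> * N - real (n + 2)) / real N"
      using eventually_gt_at_top[of 0] by eventually_elim (auto simp: max_def field_simps)
    ultimately show "(\<lambda>N. max 0 (\<alpha> * N - real (n + 2)) / real N) \<longlonglongrightarrow> max 0 \<alpha>"
      by (simp add: tendsto_cong)
  qed
  have hi: "(\<lambda>N. ((\<alpha> * N + 1) / real N) ^ ?m * dyck_count n 0) \<longlonglongrightarrow> \<alpha> ^ ?m * dyck_count n 0"
  proof (intro tendsto_intros)
    have "(\<lambda>N. \<alpha> + 1 / real N) \<longlonglongrightarrow> \<alpha> + 0"
      by (intro tendsto_intros lim_const_over_n)
    moreover have "\<forall>\<^sub>F N in sequentially. \<alpha> + 1 / real N = (\<alpha> * N + 1) / real N"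
      using eventually_gt_at_top[of 0] by eventually_elim (auto simp: field_simps)
    ultimately show "(\<lambda>N. (\<alpha> * N + 1) / real N) \<longlonglongrightarrow> \<alpha>"
      by (simp add: tendsto_cong)
  qed
  have \<alpha>: "max 0 \<alpha> = \<alpha>" using assms by (simp add: \<alpha>_def max_def)
  have sandwich: "\<forall>\<^sub>F N in sequentially. (max 0 (\<alpha> * N - real (n + 2)) / real N) ^ ?m * dyck_count n 0
      \<le> card (dyck_walks k N n) / (real N * sqrt N ^ n) \<and>
      card (dyck_walks k N n) / (real N * sqrt N ^ n) \<le> ((\<alpha> * N + 1) / real N) ^ ?m * dyck_count n 0"
    using eventually_gt_at_top[of 0]
  proof eventually_elim
    case (elim N)
    have *: "(z / real N) ^ ?m * dyck_count n 0 = real N * (z ^ ?m * dyck_count n 0) / (real N * real N ^ ?m)" for z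
      using elim by (simp add: power_divide)
    show ?case unfolding sq * using card_dyck_walks_bounds[OF assms, of N n, folded \<alpha>_def]
      by (intro conjI divide_right_mono) auto
  qed
  show ?thesis
    unfolding \<alpha>_def[symmetric]
    by (rule tendsto_sandwich[OF _ _ lo[unfolded \<alpha>] hi]) (use sandwich in \<open>auto elim: eventually_mono\<close>)
qed

lemma sum_weight_limit:
  assumes "1 \<le> k" "\<mu> 1 = 0" "\<mu> 2 = 1"
  shows "(\<lambda>N. (\<Sum>w\<in>walks k N n. weight \<mu> (ledges w)) / (real N * sqrt N ^ n))
     \<longlonglongrightarrow> (1 - 1 / real k) ^ (n div 2) * dyck_count n 0"
proof -
  let ?q = "(n + 1) div 2"
  define C where "C = moment_bound \<mu> n * real ?q ^ Suc n"
  define S where "S N = (\<Sum>w\<in>walks k N n. weight \<mu> (ledges w))" for N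
  have "(\<lambda>N. S N / (real N * sqrt N ^ n) - card (dyck_walks k N n) / (real N * sqrt N ^ n)) \<longlonglongrightarrow> 0"
  proof (rule Lim_null_comparison)
    show "\<forall>\<^sub>F N in sequentially. norm (S N / (real N * sqrt N ^ n) - card (dyck_walks k N n) / (real N * sqrt N ^ n)) \<le> C / sqrt N"
      using eventually_gt_at_top[of 0]
    proof eventually_elim
      case (elim N)
      have N: "1 \<le> sqrt N" "sqrt N * sqrt N = N" "0 < sqrt N" using elim by auto
      have C: "0 \<le> C" by (simp add: C_def moment_bound_nonneg)
      have "\<bar>S N - card (dyck_walks k N n)\<bar> \<le> C * real N ^ ?q"
        using sum_weight_approx[OF assms(2,3) elim, of k n] by (simp add: C_def S_def mult_ac)
      also have "real N ^ ?q = sqrt N ^ (2 * ?q)" by (simp add: power_mult)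
      also have "\<dots> \<le> sqrt N ^ (n + 1)" using N by (intro power_increasing) auto
      finally have "\<bar>S N - card (dyck_walks k N n)\<bar> \<le> C * sqrt N ^ (n + 1)"
        using C by (simp add: mult_left_mono)
      then have "\<bar>S N - card (dyck_walks k N n)\<bar> / (real N * sqrt N ^ n) \<le> C * sqrt N ^ (n + 1) / (real N * sqrt N ^ n)"
        by (intro divide_right_mono) auto
      also have "\<dots> = C * sqrt N / (sqrt N * sqrt N)" using N by (simp add: field_simps)
      also have "\<dots> = C / sqrt N" using N(3) by (simp del: real_sqrt_mult_self)
      finally show ?case by (simp add: diff_divide_distrib[symmetric] abs_mult)
    qed
    show "(\<lambda>N. C / sqrt N) \<longlonglongrightarrow> 0" by real_asymp
  qed
  from tendsto_add[OF this card_dyck_walks_limit[OF assms(1), of n]]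
  show ?thesis by (simp add: S_def)
qed

subsection \<open>Traces of powers of random checkerboard matrices\<close>

lemma prod_list_eq_prod_count:
  fixes f :: "'b \<Rightarrow> 'c::comm_monoid_mult"
  shows "prod_list (map f es) = (\<Prod>e\<in>set es. f e ^ count_list es e)"
proof (induction es)
  case (Cons a es)
  show ?case
  proof (cases "a \<in> set es")
    case True
    then have "set es = insert a (set es - {a})" by blast
    then have split: "(\<Prod>e\<in>set es. g e) = g a * (\<Prod>e\<in>set es - {a}. g e)" for g :: "'b \<Rightarrow> 'c"
      using prod.remove[of "set es" a g] True by simp
    have "(\<Prod>e\<in>set es - {a}. f e ^ count_list (a # es) e) = (\<Prod>e\<in>set es - {a}. f e ^ count_list es e)"
      by (intro prod.cong) auto
    then have "(\<Prod>e\<in>set es. f e ^ count_list (a # es) e) = f a * (\<Prod>e\<in>set es. f e ^ count_list es e)"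
      unfolding split by (simp add: mult.assoc)
    then show ?thesis using Cons True by (simp add: insert_absorb)
  next
    case False
    then have "(\<Prod>e\<in>set es. f e ^ count_list (a # es) e) = (\<Prod>e\<in>set es. f e ^ count_list es e)"
      by (intro prod.cong) auto
    then show ?thesis using Cons False by simp
  qed
qed simp

lemma walks_edge:
  assumes "w \<in> walks k N n" "(i, j) \<in> set (ledges w)"
  shows "i < j" "j < N" "i mod k \<noteq> j mod k"
proof -
  show al: "i mod k \<noteq> j mod k" using assms by (auto simp: walks_def allowed_def)
  obtain xs a b ys where "(i, j) = edge a b" using assms(2) by (rule in_ledgesE)
  then have "i \<le> j" by (auto simp: edge_def)
  then show "i < j" using al by (metis le_neq_implies_less)
  show "j < N" using ledges_within[OF assms(2)] assms(1) by (auto simp: edge_within_def walks_def)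
qed

text \<open>The sum of the squares has finite expectation, so it is finite almost surely, and the
  terms of a convergent series tend to 0.\<close>

lemma (in prob_space) AE_tendsto_0_of_summable_second_moments:
  fixes Y :: "nat \<Rightarrow> 'a \<Rightarrow> real"
  assumes int: "\<And>N. integrable M (\<lambda>\<omega>. (Y N \<omega>)\<^sup>2)"
    and bound: "\<And>N. expectation (\<lambda>\<omega>. (Y N \<omega>)\<^sup>2) \<le> c N" and "summable c"
  shows "AE \<omega> in M. (\<lambda>N. Y N \<omega>) \<longlonglongrightarrow> 0"
proof -
  have [measurable]: "(\<lambda>\<omega>. (Y N \<omega>)\<^sup>2) \<in> borel_measurable M" for N using int by simp
  have c: "0 \<le> c N" for N
    by (rule order_trans[OF _ bound]) simp
  have "(\<integral>\<^sup>+\<omega>. (\<Sum>N. ennreal ((Y N \<omega>)\<^sup>2)) \<partial>M) = (\<Sum>N. \<integral>\<^sup>+\<omega>. ennreal ((Y N \<omega>)\<^sup>2) \<partial>M)"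
    by (rule nn_integral_suminf) measurable
  also have "\<dots> = (\<Sum>N. ennreal (expectation (\<lambda>\<omega>. (Y N \<omega>)\<^sup>2)))"
    using int by (subst nn_integral_eq_integral) auto
  also have "\<dots> \<le> (\<Sum>N. ennreal (c N))"
    by (intro suminf_le ennreal_leI bound) auto
  also have "\<dots> = ennreal (\<Sum>N. c N)"
    using c assms(3) by (intro suminf_ennreal2) auto
  finally have "(\<integral>\<^sup>+\<omega>. (\<Sum>N. ennreal ((Y N \<omega>)\<^sup>2)) \<partial>M) < \<infinity>"
    by (simp add: order_le_less_trans[OF _ ennreal_less_top])
  then have "AE \<omega> in M. (\<Sum>N. ennreal ((Y N \<omega>)\<^sup>2)) \<noteq> \<infinity>"
    by (intro nn_integral_PInf_AE) auto
  then show ?thesis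
  proof eventually_elim
    case (elim \<omega>)
    then have "summable (\<lambda>N. (Y N \<omega>)\<^sup>2)"
      by (intro summable_suminf_not_top) (auto simp: top_unique)
    then have "(\<lambda>N. (Y N \<omega>)\<^sup>2) \<longlonglongrightarrow> 0" by (rule summable_LIMSEQ_zero)
    then have "(\<lambda>N. sqrt ((Y N \<omega>)\<^sup>2)) \<longlonglongrightarrow> sqrt 0" by (rule tendsto_real_sqrt)
    then show ?case by (simp add: tendsto_rabs_zero_iff)
  qed
qed

text \<open>The method of moments sees a common law through its moments, so identical distribution
  appears as one sequence \<open>\<mu>\<close> shared by all positions and all sizes
  \<open>N\<close>.\<close>

locale checkerboard_entries = prob_space M
  for M :: "'a measure" and k :: nat and X :: "nat \<Rightarrow> nat \<Rightarrow> nat \<Rightarrow> 'a \<Rightarrow> real" and \<mu> :: "nat \<Rightarrow> real" +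
  assumes k: "1 \<le> k"
    and indep: "indep_vars (\<lambda>_. borel) (\<lambda>(N, i, j). X N i j) {(N, i, j). i < j \<and> j < N \<and> i mod k \<noteq> j mod k}"
    and integrable_moment: "\<And>N i j m. i < j \<Longrightarrow> j < N \<Longrightarrow> i mod k \<noteq> j mod k \<Longrightarrow> integrable M (\<lambda>\<omega>. X N i j \<omega> ^ m)"
    and moment: "\<And>N i j m. i < j \<Longrightarrow> j < N \<Longrightarrow> i mod k \<noteq> j mod k \<Longrightarrow> expectation (\<lambda>\<omega>. X N i j \<omega> ^ m) = \<mu> m"
    and mean: "\<mu> 1 = 0" and variance: "\<mu> 2 = 1"
begin

definition walk_product :: "nat \<Rightarrow> (nat \<times> nat) list \<Rightarrow> 'a \<Rightarrow> real" where
  "walk_product N es \<omega> = prod_list (map (\<lambda>(i, j). X N i j \<omega>) es)"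

lemma
  assumes es: "\<And>i j. (i, j) \<in> set es \<Longrightarrow> i < j \<and> j < N \<and> i mod k \<noteq> j mod k"
  shows integrable_walk_product: "integrable M (walk_product N es)"
    and expectation_walk_product: "expectation (walk_product N es) = weight \<mu> es"
proof -
  let ?J = "Pair N ` set es"
  let ?Y = "\<lambda>t \<omega>. (\<lambda>(N, i, j). X N i j) t \<omega> ^ count_list es (snd t)"
  have "indep_vars (\<lambda>_. borel) (\<lambda>(N, i, j). X N i j) ?J"
    using es by (intro indep_vars_subset[OF indep]) auto
  then have ind: "indep_vars (\<lambda>_. borel) ?Y ?J"
    by (rule indep_vars_compose2) simp
  have int: "integrable M (?Y t)" if "t \<in> ?J" for t
    using es integrable_moment that by auto
  have inj: "inj_on (Pair N) A" for A :: "(nat \<times> nat) set" by (simp add: inj_on_def)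
  \<comment> \<open>Repeated edges are first collected into powers, because independence applies to
    entries at distinct edges.\<close>
  have eq: "walk_product N es = (\<lambda>\<omega>. \<Prod>t\<in>?J. ?Y t \<omega>)"
    unfolding walk_product_def prod_list_eq_prod_count prod.reindex[OF inj]
    by (intro ext prod.cong) auto
  show "integrable M (walk_product N es)"
    unfolding eq by (intro indep_vars_integrable ind int) auto
  have "expectation (walk_product N es) = (\<Prod>t\<in>?J. expectation (?Y t))"
    unfolding eq by (intro indep_vars_lebesgue_integral ind int) auto
  also have "\<dots> = weight \<mu> es"
    unfolding weight_def prod.reindex[OF inj] using es moment by (intro prod.cong) auto
  finally show "expectation (walk_product N es) = weight \<mu> es" .
qed

definition walk_sum :: "nat \<Rightarrow> nat \<Rightarrow> 'a \<Rightarrow> real" where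
  "walk_sum n N \<omega> = (\<Sum>w\<in>walks k N n. walk_product N (ledges w) \<omega>)"

lemma integrable_walk_sum: "integrable M (walk_sum n N)"
  unfolding walk_sum_def using walks_edge
  by (intro Bochner_Integration.integrable_sum integrable_walk_product) blast

lemma expectation_walk_sum: "expectation (walk_sum n N) = (\<Sum>w\<in>walks k N n. weight \<mu> (ledges w))"
proof -
  have "expectation (walk_sum n N) = (\<Sum>w\<in>walks k N n. expectation (walk_product N (ledges w)))"
    unfolding walk_sum_def using walks_edge
    by (intro Bochner_Integration.integral_sum integrable_walk_product) blast
  also have "\<dots> = (\<Sum>w\<in>walks k N n. weight \<mu> (ledges w))"
    using walks_edge by (intro sum.cong expectation_walk_product) blast+
  finally show ?thesis .
qed

lemma walk_sum_squared:
  "(walk_sum n N \<omega>)\<^sup>2 = (\<Sum>(w, w')\<in>walks k N n \<times> walks k N n. walk_product N (ledges w @ ledges w') \<omega>)"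
  by (simp add: power2_eq_square walk_sum_def sum_product sum.cartesian_product walk_product_def)

lemma walks_edge_append:
  assumes "w \<in> walks k N n" "w' \<in> walks k N n" "(i, j) \<in> set (ledges w @ ledges w')"
  shows "i < j \<and> j < N \<and> i mod k \<noteq> j mod k"
  using assms walks_edge[of w k N n i j] walks_edge[of w' k N n i j] by auto

lemma integrable_walk_sum_squared: "integrable M (\<lambda>\<omega>. (walk_sum n N \<omega>)\<^sup>2)"
  unfolding walk_sum_squared
  by (intro Bochner_Integration.integrable_sum)
    (auto intro!: integrable_walk_product dest: walks_edge_append)

lemma expectation_walk_sum_squared:
  "expectation (\<lambda>\<omega>. (walk_sum n N \<omega>)\<^sup>2) =
     (\<Sum>(w, w')\<in>walks k N n \<times> walks k N n. weight \<mu> (ledges w @ ledges w'))"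
proof -
  have "expectation (\<lambda>\<omega>. (walk_sum n N \<omega>)\<^sup>2) =
     (\<Sum>p\<in>walks k N n \<times> walks k N n. expectation (\<lambda>\<omega>. case p of (w, w') \<Rightarrow> walk_product N (ledges w @ ledges w') \<omega>))"
    unfolding walk_sum_squared
    by (intro Bochner_Integration.integral_sum)
      (auto intro!: integrable_walk_product dest: walks_edge_append)
  also have "\<dots> = (\<Sum>(w, w')\<in>walks k N n \<times> walks k N n. weight \<mu> (ledges w @ ledges w'))"
    by (intro sum.cong) (auto intro!: expectation_walk_product dest: walks_edge_append)
  finally show ?thesis .
qed

text \<open>The variance is the sum of covariances over pairs of walks, each a joint weight minus a
  product of weights. Division by the square of \<open>N * sqrt N ^ n\<close> cancels
  \<open>N ^ n\<close> and leaves the summable factor \<open>1 / N ^ 2\<close>.\<close>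

lemma variance_walk_sum_le:
  assumes "0 < N"
  shows "variance (walk_sum n N) \<le>
    (moment_bound \<mu> (2 * n) + (moment_bound \<mu> n)\<^sup>2) * (real N ^ n * real n ^ (2 * Suc n))"
proof -
  have "variance (walk_sum n N) = expectation (\<lambda>\<omega>. (walk_sum n N \<omega>)\<^sup>2) - (expectation (walk_sum n N))\<^sup>2"
    by (intro variance_eq integrable_walk_sum integrable_walk_sum_squared)
  also have "\<dots> = (\<Sum>(w, w')\<in>walks k N n \<times> walks k N n.
      weight \<mu> (ledges w @ ledges w') - weight \<mu> (ledges w) * weight \<mu> (ledges w'))"
  proof -
    have "(expectation (walk_sum n N))\<^sup>2 = (\<Sum>(w, w')\<in>walks k N n \<times> walks k N n. weight \<mu> (ledges w) * weight \<mu> (ledges w'))"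
      unfolding expectation_walk_sum power2_eq_square sum_product by (rule sum.cartesian_product)
    then show ?thesis
      unfolding expectation_walk_sum_squared by (simp only: sum_subtractf case_prod_unfold)
  qed
  also have "\<dots> \<le> (moment_bound \<mu> (2 * n) + (moment_bound \<mu> n)\<^sup>2) * (real N ^ n * real n ^ (2 * Suc n))"
    using mean assms by (rule sum_weight_covariance_le)
  finally show ?thesis .
qed

lemma AE_walk_sum_limit:
  "AE \<omega> in M. (\<lambda>N. walk_sum n N \<omega> / (real N * sqrt N ^ n))
     \<longlonglongrightarrow> (1 - 1 / real k) ^ (n div 2) * dyck_count n 0"
proof -
  define C where "C = (moment_bound \<mu> (2 * n) + (moment_bound \<mu> n)\<^sup>2) * real n ^ (2 * Suc n)"
  define Y where "Y N \<omega> = (walk_sum n N \<omega> - expectation (walk_sum n N)) / (real N * sqrt N ^ n)" for N \<omega>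
  have Y2: "(Y N \<omega>)\<^sup>2 = (walk_sum n N \<omega> - expectation (walk_sum n N))\<^sup>2 / (real N ^ 2 * real N ^ n)" for N \<omega>
  proof -
    have "(sqrt N ^ n)\<^sup>2 = real N ^ n"
      by (metis of_nat_0_le_iff power_mult mult.commute real_sqrt_pow2)
    then show ?thesis by (simp add: Y_def power_divide power_mult_distrib)
  qed
  have int: "integrable M (\<lambda>\<omega>. (walk_sum n N \<omega> - c)\<^sup>2)" for N c
    unfolding power2_diff using integrable_walk_sum integrable_walk_sum_squared by auto
  have "AE \<omega> in M. (\<lambda>N. Y N \<omega>) \<longlonglongrightarrow> 0"
  proof (rule AE_tendsto_0_of_summable_second_moments)
    show "integrable M (\<lambda>\<omega>. (Y N \<omega>)\<^sup>2)" for N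
      unfolding Y2 using int by auto
    show "expectation (\<lambda>\<omega>. (Y N \<omega>)\<^sup>2) \<le> C * (1 / real N ^ 2)" for N
    \<comment> \<open>For \<open>N = 0\<close> both sides are 0, since division by zero gives
      0.\<close>
    proof (cases "N = 0")
      case False
      then have "variance (walk_sum n N) \<le> C * real N ^ n"
        using variance_walk_sum_le[of N n] by (simp add: C_def mult_ac)
      then have "variance (walk_sum n N) / (real N ^ 2 * real N ^ n) \<le> C * real N ^ n / (real N ^ 2 * real N ^ n)"
        by (intro divide_right_mono) auto
      then show ?thesis unfolding Y2 using False by simp
    qed (simp add: Y_def)
    show "summable (\<lambda>N. C * (1 / real N ^ 2))"
      using inverse_power_summable[of 2, where 'a = real]
      by (intro summable_mult) (simp add: inverse_eq_divide)
  qed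
  then show ?thesis
  proof eventually_elim
    case (elim \<omega>)
    have "(\<lambda>N. Y N \<omega> + expectation (walk_sum n N) / (real N * sqrt N ^ n)) \<longlonglongrightarrow>
       0 + (1 - 1 / real k) ^ (n div 2) * dyck_count n 0"
      unfolding expectation_walk_sum
      by (intro tendsto_add elim sum_weight_limit k mean variance)
    then show ?case by (simp add: Y_def diff_divide_distrib)
  qed
qed

end

subsection \<open>Moments of the semicircle law\<close>

lemma dyck_count_le: "dyck_count n h \<le> 2 ^ n"
proof (induction n arbitrary: h)
  case (Suc n)
  have "dyck_count (Suc n) h \<le> 2 ^ n + 2 ^ n"
    using Suc.IH[of "Suc h"] Suc.IH[of "h - 1"] by auto
  then show ?case by simp
qed auto

lemma integral_cos_nat_mult: "integral {0..pi} (\<lambda>\<theta>. cos (real m * \<theta>)) = (if m = 0 then pi else 0)"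
proof (cases "m = 0")
  case False
  have "((\<lambda>\<theta>. cos (real m * \<theta>)) has_integral (sin (real m * pi) / m - sin (real m * 0) / m)) {0..pi}"
  proof (rule fundamental_theorem_of_calculus)
    show "((\<lambda>\<theta>. sin (real m * \<theta>) / m) has_vector_derivative cos (real m * x)) (at x within {0..pi})" for x
      using False by (auto intro!: derivative_eq_intros simp flip: has_real_derivative_iff_has_vector_derivative)
  qed simp
  then show ?thesis using False by (simp add: integral_unique)
qed simp

text \<open>With \<open>x = - 2 * cos \<theta>\<close> the factor
  \<open>(- 1) ^ h * sin (real (Suc h) * \<theta>)\<close> is U_h(x/2) times
  \<open>sin \<theta>\<close>, where U_h is the Chebyshev polynomial of the second kind. The
  integrand is thus x^n U_h(x/2) against the semicircle weight. The minus sign makes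
  \<open>x\<close> increase with \<open>\<theta>\<close>, as the later substitution
  requires.\<close>

definition cheb_integral :: "nat \<Rightarrow> nat \<Rightarrow> real" where
  "cheb_integral n h = integral {0..pi} (\<lambda>\<theta>. (- (2 * cos \<theta>)) ^ n * ((- 1) ^ h * sin (real (Suc h) * \<theta>) * sin \<theta>))"

text \<open>With \<open>x = - 2 cos \<theta>\<close>, the Chebyshev polynomials of the second kind satisfy
  \<open>x * U\<^sub>h = U\<^sub>h\<^sub>+\<^sub>1 + U\<^sub>h\<^sub>-\<^sub>1\<close>, which is the recursion of \<open>dyck_count\<close>.\<close>
lemma cheb_integral_eq: "cheb_integral n h = pi / 2 * dyck_count n h"
proof (induction n arbitrary: h)
  case 0
  have "cheb_integral 0 h = integral {0..pi} (\<lambda>\<theta>. (- 1) ^ h / 2 * (cos (real h * \<theta>) - cos (real (h + 2) * \<theta>)))"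
    unfolding cheb_integral_def
  proof (intro Henstock_Kurzweil_Integration.integral_cong)
    fix \<theta> :: real
    have "cos (real h * \<theta>) - cos (real (h + 2) * \<theta>) = 2 * (sin (real (Suc h) * \<theta>) * sin \<theta>)"
      using cos_add[of "real (Suc h) * \<theta>" \<theta>] cos_diff[of "real (Suc h) * \<theta>" \<theta>]
      by (simp add: algebra_simps)
    then show "(- (2 * cos \<theta>)) ^ 0 * ((- 1) ^ h * sin (real (Suc h) * \<theta>) * sin \<theta>) = (- 1) ^ h / 2 * (cos (real h * \<theta>) - cos (real (h + 2) * \<theta>))"
      by simp
  qed
  also have "\<dots> = (- 1) ^ h / 2 * (integral {0..pi} (\<lambda>\<theta>. cos (real h * \<theta>)) - integral {0..pi} (\<lambda>\<theta>. cos (real (h + 2) * \<theta>)))"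
    by (subst Henstock_Kurzweil_Integration.integral_mult_right, subst Henstock_Kurzweil_Integration.integral_diff)
      (auto intro!: integrable_continuous_real continuous_intros)
  also have "\<dots> = pi / 2 * dyck_count 0 h"
    unfolding integral_cos_nat_mult by simp
  finally show ?case .
next
  case (Suc n)
  let ?f = "\<lambda>h \<theta>. (- (2 * cos \<theta>)) ^ n * ((- 1) ^ h * sin (real (Suc h) * \<theta>) * sin \<theta>) :: real"
  have "cheb_integral (Suc n) h = integral {0..pi} (\<lambda>\<theta>. ?f (Suc h) \<theta> + (if h = 0 then 0 else ?f (h - 1) \<theta>))"
    unfolding cheb_integral_def
  proof (intro Henstock_Kurzweil_Integration.integral_cong)
    fix \<theta> :: real
    have *: "2 * cos \<theta> * sin (real (Suc h) * \<theta>) = sin (real (Suc (Suc h)) * \<theta>) + sin (real h * \<theta>)"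
      using sin_add[of "real (Suc h) * \<theta>" \<theta>] sin_diff[of "real (Suc h) * \<theta>" \<theta>]
      by (simp add: algebra_simps)
    have "(- (2 * cos \<theta>)) ^ Suc n * ((- 1) ^ h * sin (real (Suc h) * \<theta>) * sin \<theta>)
      = (- (2 * cos \<theta>)) ^ n * ((- 1) ^ Suc h * (2 * cos \<theta> * sin (real (Suc h) * \<theta>)) * sin \<theta>)"
      by (simp add: algebra_simps)
    also have "\<dots> = ?f (Suc h) \<theta> + (- (2 * cos \<theta>)) ^ n * ((- 1) ^ Suc h * sin (real h * \<theta>) * sin \<theta>)"
      unfolding * by (simp add: algebra_simps)
    \<comment> \<open>At \<open>h = 0\<close> the sine vanishes, which matches the rule that a path
      at height 0 cannot go down.\<close>
    also have "(- (2 * cos \<theta>)) ^ n * ((- 1) ^ Suc h * sin (real h * \<theta>) * sin \<theta>) = (if h = 0 then 0 else ?f (h - 1) \<theta>)"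
      by (cases h) auto
    finally show "(- (2 * cos \<theta>)) ^ Suc n * ((- 1) ^ h * sin (real (Suc h) * \<theta>) * sin \<theta>) =
       ?f (Suc h) \<theta> + (if h = 0 then 0 else ?f (h - 1) \<theta>)" .
  qed
  also have "\<dots> = cheb_integral n (Suc h) + (if h = 0 then 0 else cheb_integral n (h - 1))"
    unfolding cheb_integral_def
    by (cases "h = 0", simp, simp only: if_False, subst Henstock_Kurzweil_Integration.integral_add)
      (auto intro!: integrable_continuous_real continuous_intros)
  also have "\<dots> = pi / 2 * dyck_count (Suc n) h"
    unfolding Suc.IH by (simp add: algebra_simps)
  finally show ?case .
qed

section \<open>The semicircle law as a distribution and its moments\<close>

definition semicircle_density :: "real \<Rightarrow> real \<Rightarrow> real" where
  "semicircle_density R x = (if \<bar>x\<bar> \<le> R then 2 / (pi * R\<^sup>2) * sqrt (R\<^sup>2 - x\<^sup>2) else 0)"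

lemma semicircle_density_nonneg: "0 \<le> semicircle_density R x"
proof (cases "\<bar>x\<bar> \<le> R")
  case True
  then have "x\<^sup>2 \<le> R\<^sup>2" by (metis abs_ge_zero power2_abs power_mono)
  then show ?thesis by (simp add: semicircle_density_def)
qed (simp add: semicircle_density_def)

lemma borel_measurable_semicircle_density [measurable]: "semicircle_density R \<in> borel_measurable borel"
  unfolding semicircle_density_def[abs_def] by measurable

text \<open>The substitution \<open>x = - (R * cos \<theta>)\<close> turns the density together with
  its Jacobian into a multiple of the squared sine, and \<open>x ^ n\<close> into
  \<open>(R / 2) ^ n\<close> times the power in \<open>cheb_integral n 0\<close>.\<close>

lemma
  assumes "0 < R"
  shows integrable_semicircle_density: "integrable lborel (\<lambda>x. semicircle_density R x * x ^ n)" (is ?int)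
    and integral_semicircle_density: "(\<integral>x. semicircle_density R x * x ^ n \<partial>lborel) = (R / 2) ^ n * dyck_count n 0" (is ?eq)
proof -
  let ?f = "\<lambda>x. 2 / (pi * R\<^sup>2) * sqrt (R\<^sup>2 - x\<^sup>2) * x ^ n"
  let ?g = "\<lambda>\<theta>. - (R * cos \<theta>)" and ?g' = "\<lambda>\<theta>. R * sin \<theta>"
  have ind: "semicircle_density R x * x ^ n = indicator {?g 0..?g pi} x *\<^sub>R ?f x" for x
    by (auto simp: semicircle_density_def indicator_def)
  have fint: "set_integrable lborel {?g 0..?g pi} ?f"
    using assms by (intro borel_integrable_compact[unfolded set_integrable_def[symmetric]]) (auto intro!: continuous_intros)
  then show ?int unfolding ind set_integrable_def .
  note deriv = integral_substitution[where f = ?f and g = ?g and g' = ?g' and a = 0 and b = pi, OF fint]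
  have sub: "set_integrable lborel {0..pi} (\<lambda>\<theta>. ?f (?g \<theta>) * ?g' \<theta>)"
    "(LBINT x. ?f x * indicator {?g 0..?g pi} x) = (LBINT \<theta>. ?f (?g \<theta>) * ?g' \<theta> * indicator {0..pi} \<theta>)"
    by ((rule deriv; use assms in \<open>auto intro!: derivative_eq_intros continuous_intros mult_nonneg_nonneg sin_ge_zero\<close>)[1])+
  have "(\<integral>x. semicircle_density R x * x ^ n \<partial>lborel) = (LBINT x. ?f x * indicator {?g 0..?g pi} x)"
    unfolding ind by (simp add: mult.commute)
  also have "\<dots> = (LBINT \<theta>:{0..pi}. ?f (?g \<theta>) * ?g' \<theta>)"
    unfolding sub(2) set_lebesgue_integral_def by (simp add: mult.commute)
  also have "\<dots> = integral {0..pi} (\<lambda>\<theta>. ?f (?g \<theta>) * ?g' \<theta>)"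
    by (rule set_borel_integral_eq_integral(2)[OF sub(1)])
  also have "\<dots> = integral {0..pi} (\<lambda>\<theta>. 2 / pi * (R / 2) ^ n * ((- (2 * cos \<theta>)) ^ n * ((- 1) ^ 0 * sin (real (Suc 0) * \<theta>) * sin \<theta>)))"
  proof (intro Henstock_Kurzweil_Integration.integral_cong)
    fix \<theta> :: real assume "\<theta> \<in> {0..pi}"
    then have "0 \<le> sin \<theta>" by (auto intro: sin_ge_zero)
    moreover have "R\<^sup>2 - (?g \<theta>)\<^sup>2 = (R * sin \<theta>)\<^sup>2"
      by (simp add: power_mult_distrib sin_squared_eq algebra_simps)
    ultimately have "sqrt (R\<^sup>2 - (?g \<theta>)\<^sup>2) = R * sin \<theta>" using assms by simp
    moreover have "(?g \<theta>) ^ n = (R / 2) ^ n * (- (2 * cos \<theta>)) ^ n"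
      by (simp flip: power_mult_distrib)
    ultimately show "?f (?g \<theta>) * ?g' \<theta> = 2 / pi * (R / 2) ^ n * ((- (2 * cos \<theta>)) ^ n * ((- 1) ^ 0 * sin (real (Suc 0) * \<theta>) * sin \<theta>))"
      using assms by (simp add: power2_eq_square)
  qed
  also have "\<dots> = 2 / pi * (R / 2) ^ n * cheb_integral n 0"
    unfolding cheb_integral_def by (rule Henstock_Kurzweil_Integration.integral_mult_right)
  also have "\<dots> = (R / 2) ^ n * dyck_count n 0" by (simp add: cheb_integral_eq)
  finally show ?eq .
qed

lemma semicircle_measure_eq_density:
  "R \<noteq> 0 \<Longrightarrow> semicircle_measure R = density lborel (\<lambda>x. ennreal (semicircle_density R x))"
  by (simp add: semicircle_measure_def semicircle_density_def)

lemma real_distribution_semicircle: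
  assumes "0 \<le> R"
  shows "real_distribution (semicircle_measure R)"
proof (cases "R = 0")
  case True
  then show ?thesis
    unfolding semicircle_measure_def
    by (auto intro!: real_distribution.intro prob_space_return simp: real_distribution_axioms_def)
next
  case False
  then have R: "0 < R" using assms by simp
  \<comment> \<open>The total mass is the moment of order 0, which the general formula evaluates as
    \<open>dyck_count 0 0 = 1\<close>.\<close>
  have "emeasure (semicircle_measure R) UNIV = (\<integral>\<^sup>+x. ennreal (semicircle_density R x) \<partial>lborel)"
    unfolding semicircle_measure_eq_density[OF False] by (subst emeasure_density) auto
  also have "\<dots> = ennreal (\<integral>x. semicircle_density R x \<partial>lborel)"
    using integrable_semicircle_density[OF R, of 0]
    by (intro nn_integral_eq_integral) (auto simp: semicircle_density_nonneg)
  also have "\<dots> = 1" using integral_semicircle_density[OF R, of 0] by simp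
  finally have "prob_space (semicircle_measure R)"
    by (intro prob_spaceI) (simp add: semicircle_measure_eq_density[OF False])
  then show ?thesis
    by (auto intro!: real_distribution.intro simp: real_distribution_axioms_def semicircle_measure_eq_density[OF False])
qed

lemma
  assumes "0 \<le> R"
  shows integrable_semicircle_power: "integrable (semicircle_measure R) (\<lambda>x. x ^ n)"
    and integral_semicircle_power: "(\<integral>x. x ^ n \<partial>semicircle_measure R) = (R / 2) ^ n * dyck_count n 0"
proof -
  have "integrable (semicircle_measure R) (\<lambda>x. x ^ n) \<and>
     (\<integral>x. x ^ n \<partial>semicircle_measure R) = (R / 2) ^ n * dyck_count n 0"
  proof (cases "R = 0")
    case True
    interpret real_distribution "semicircle_measure R" by (rule real_distribution_semicircle[OF assms])
    have meas: "(\<lambda>x::real. x ^ n) \<in> borel_measurable borel" by simp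
    have "semicircle_measure R = return borel 0" using True by (simp add: semicircle_measure_def)
    then have "AE x in semicircle_measure R. x = 0"
      by (simp only:, subst AE_return) auto
    then have "AE x in semicircle_measure R. norm (x ^ n) \<le> 1"
      by eventually_elim (simp add: power_0_left)
    then have "integrable (semicircle_measure R) (\<lambda>x. x ^ n)"
      by (rule integrable_const_bound) simp
    moreover have "(\<integral>x. x ^ n \<partial>semicircle_measure R) = 0 ^ n"
      using True meas by (simp add: semicircle_measure_def integral_return)
    moreover have "(0::real) ^ n = (R / 2) ^ n * dyck_count n 0" using True by (cases n) auto
    ultimately show ?thesis by simp
  next
    case False
    then have R: "0 < R" using assms by simp
    show ?thesis
      unfolding semicircle_measure_eq_density[OF False]
      using integrable_semicircle_density[OF R, of n] integral_semicircle_density[OF R, of n]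
      by (subst integrable_density integral_density; simp add: semicircle_density_nonneg)+
  qed
  then show "integrable (semicircle_measure R) (\<lambda>x. x ^ n)"
    "(\<integral>x. x ^ n \<partial>semicircle_measure R) = (R / 2) ^ n * dyck_count n 0" by auto
qed

text \<open>Characteristic functions are compared through their Taylor polynomials. The growth bound
  makes the remainder for \<open>\<sigma>\<close> small at a suitable order, and convergence of the
  moment of that order transfers this to \<open>\<nu> N\<close> for large \<open>N\<close>; the
  polynomials converge termwise. Integrability at \<open>N = 0\<close> is left open because the
  empirical measure is unspecified there.\<close>

lemma weak_conv_m_of_moments:
  fixes \<nu> :: "nat \<Rightarrow> real measure" and \<sigma> :: "real measure"
  assumes \<nu>: "\<And>N. real_distribution (\<nu> N)" and \<sigma>: "real_distribution \<sigma>"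
    and int: "\<And>N n. 0 < N \<Longrightarrow> integrable (\<nu> N) (\<lambda>x. x ^ n)" "\<And>n. integrable \<sigma> (\<lambda>x. x ^ n)"
    and lim: "\<And>n. (\<lambda>N. \<integral>x. x ^ n \<partial>\<nu> N) \<longlonglongrightarrow> (\<integral>x. x ^ n \<partial>\<sigma>)"
    and bound: "\<And>n. even n \<Longrightarrow> (\<integral>x. x ^ n \<partial>\<sigma>) \<le> R ^ n"
  shows "weak_conv_m \<nu> \<sigma>"
proof (rule levy_continuity[OF \<nu> \<sigma>])
  fix t :: real
  define T where "T \<rho> n = (\<Sum>k\<le>n. ((\<i> * t) ^ k / fact k) * complex_of_real (\<integral>x. x ^ k \<partial>\<rho>))" for \<rho> n
  show "(\<lambda>N. char (\<nu> N) t) \<longlonglongrightarrow> char \<sigma> t"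
  proof (rule LIMSEQ_I)
    fix e :: real assume e: "0 < e"
    have "(\<lambda>n. inverse (fact n) * (\<bar>t\<bar> * R) ^ n) \<longlonglongrightarrow> 0"
      by (intro summable_LIMSEQ_zero summable_exp)
    then have "\<forall>\<^sub>F n in sequentially. norm (inverse (fact n) * (\<bar>t\<bar> * R) ^ n) < e / 8"
      using e by (intro order_tendstoD(2)[of _ 0] tendsto_norm_zero) auto
    then obtain m where m: "\<And>n. m \<le> n \<Longrightarrow> norm (inverse (fact n) * (\<bar>t\<bar> * R) ^ n) < e / 8"
      by (auto simp: eventually_sequentially)
    \<comment> \<open>An even order, so that the absolute moment in the Taylor remainder is an
      ordinary moment.\<close>
    define n where "n = 2 * m"
    have n: "even n" "m \<le> n" by (auto simp: n_def)
    let ?b = "2 * \<bar>t\<bar> ^ n / fact n"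
    have approx: "cmod (char \<rho> t - T \<rho> n) \<le> ?b * (\<integral>x. x ^ n \<partial>\<rho>)"
      if "real_distribution \<rho>" "\<And>n. integrable \<rho> (\<lambda>x. x ^ n)" for \<rho>
      using real_distribution.char_approx1[OF that(1), of n t] that(2) n(1)
      by (simp add: T_def power_even_abs)
    have b: "?b * (\<integral>x. x ^ n \<partial>\<sigma>) < e / 4"
    proof -
      have "?b * (\<integral>x. x ^ n \<partial>\<sigma>) \<le> ?b * R ^ n" by (intro mult_left_mono bound n) auto
      also have "\<dots> = 2 * (inverse (fact n) * (\<bar>t\<bar> * R) ^ n)"
        by (simp add: power_mult_distrib field_simps)
      also have "\<dots> < e / 4" using m[OF n(2)] by auto
      finally show ?thesis .
    qed
    have "(\<lambda>N. ?b * (\<integral>x. x ^ n \<partial>\<nu> N)) \<longlonglongrightarrow> ?b * (\<integral>x. x ^ n \<partial>\<sigma>)"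
      by (intro tendsto_intros lim)
    then have 1: "\<forall>\<^sub>F N in sequentially. ?b * (\<integral>x. x ^ n \<partial>\<nu> N) < e / 4"
      using b by (rule order_tendstoD)
    have "(\<lambda>N. T (\<nu> N) n) \<longlonglongrightarrow> T \<sigma> n"
      unfolding T_def by (intro tendsto_intros lim)
    then have "\<forall>\<^sub>F N in sequentially. dist (T (\<nu> N) n) (T \<sigma> n) < e / 4"
      using e by (intro tendstoD) auto
    then have "\<forall>\<^sub>F N in sequentially. norm (char (\<nu> N) t - char \<sigma> t) < e"
      using 1 eventually_gt_at_top[of 0]
    proof eventually_elim
      case (elim N)
      have "char (\<nu> N) t - char \<sigma> t = (char (\<nu> N) t - T (\<nu> N) n) + (T (\<nu> N) n - T \<sigma> n) - (char \<sigma> t - T \<sigma> n)"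
        by simp
      also have "norm \<dots> \<le> norm (char (\<nu> N) t - T (\<nu> N) n) + norm (T (\<nu> N) n - T \<sigma> n) + norm (char \<sigma> t - T \<sigma> n)"
        using norm_triangle_ineq4 norm_triangle_ineq by (metis (no_types, lifting) add_mono_thms_linordered_semiring(3) order_trans)
      also have "\<dots> < e"
      proof -
        have "u + v + w < e" if "u \<le> p" "w \<le> q" "q < e / 4" "v < e / 4" "p < e / 4" for u v w p q
          using that e by linarith
        from this[OF approx[OF \<nu> int(1)[OF elim(3)]] approx[OF \<sigma> int(2)] b elim(1)[unfolded dist_norm] elim(2)]
        show ?thesis by simp
      qed
      finally show ?case .
    qed
    then show "\<exists>no. \<forall>N\<ge>no. norm (char (\<nu> N) t - char \<sigma> t) < e"
      by (simp add: eventually_sequentially)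
  qed
qed

subsection \<open>Spectra of real symmetric matrices\<close>

lemma mult_mat_vec_sum:
  assumes "A \<in> carrier_mat n n" "v \<in> carrier_vec n" "i < n"
  shows "(A *\<^sub>v v) $ i = (\<Sum>j<n. A $$ (i, j) * v $ j)"
  using assms by (auto simp: scalar_prod_def lessThan_atLeast0 intro!: sum.cong)

text \<open>A complex eigenvector \<open>w\<close> exists. Symmetry makes the Hermitian form
  \<open>?q\<close> equal to its conjugate, so the eigenvalue is real; then the real and imaginary
  parts of \<open>w\<close>, not both zero, satisfy the eigenvalue equation separately.\<close>

lemma real_symmetric_eigenvector:
  fixes A :: "real mat"
  assumes A: "A \<in> carrier_mat n n" and sym: "transpose_mat A = A" and "0 < n"
  obtains e v where "v \<in> carrier_vec n" "v \<noteq> 0\<^sub>v n" "A *\<^sub>v v = e \<cdot>\<^sub>v v"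
proof -
  define C where "C = map_mat complex_of_real A"
  have C: "C \<in> carrier_mat n n" using A by (simp add: C_def)
  obtain as where as: "char_poly C = (\<Prod>a\<leftarrow>as. [:- a, 1:])" "length as = n"
    using char_poly_factorized[OF C] by blast
  then obtain z where "z \<in> set as" using \<open>0 < n\<close> by (cases as) auto
  then have "poly (char_poly C) z = 0"
    unfolding as(1) poly_prod_list by (auto simp: prod_list_zero_iff)
  then have "eigenvalue C z" using eigenvalue_root_char_poly[OF C] by simp
  then obtain w where w: "w \<in> carrier_vec n" "w \<noteq> 0\<^sub>v n" "C *\<^sub>v w = z \<cdot>\<^sub>v w"
    using C unfolding eigenvalue_def eigenvector_def by auto
  have eq: "(\<Sum>j<n. of_real (A $$ (i, j)) * w $ j) = z * w $ i" if "i < n" for i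
  proof -
    have "(C *\<^sub>v w) $ i = (\<Sum>j<n. C $$ (i, j) * w $ j)"
      using C w(1) that by (rule mult_mat_vec_sum)
    moreover have "(z \<cdot>\<^sub>v w) $ i = z * w $ i" using w(1) that by simp
    moreover have "(\<Sum>j<n. C $$ (i, j) * w $ j) = (\<Sum>j<n. of_real (A $$ (i, j)) * w $ j)"
      using A that by (intro sum.cong refl) (simp add: C_def)
    ultimately show ?thesis unfolding w(3) by simp
  qed
  have A_sym: "A $$ (i, j) = A $$ (j, i)" if "i < n" "j < n" for i j
    using sym A that by (metis carrier_matD index_transpose_mat(1))
  let ?q = "\<Sum>i<n. \<Sum>j<n. cnj (w $ i) * (of_real (A $$ (i, j)) * w $ j)"
  let ?s = "\<Sum>i<n. (cmod (w $ i))\<^sup>2"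
  have "?q = (\<Sum>i<n. cnj (w $ i) * (z * w $ i))"
    using eq by (simp flip: sum_distrib_left)
  also have "\<dots> = (\<Sum>i<n. z * of_real ((cmod (w $ i))\<^sup>2))"
    unfolding complex_norm_square by (simp add: mult_ac)
  also have "\<dots> = z * of_real ?s" by (simp add: sum_distrib_left)
  finally have q: "?q = z * of_real ?s" .
  have "cnj ?q = (\<Sum>i<n. \<Sum>j<n. cnj (w $ j) * (of_real (A $$ (i, j)) * w $ i))"
    by (simp add: mult_ac)
  also have "\<dots> = (\<Sum>j<n. \<Sum>i<n. cnj (w $ j) * (of_real (A $$ (i, j)) * w $ i))"
    by (rule sum.swap)
  also have "\<dots> = ?q" using A_sym by (intro sum.cong refl) simp
  finally have "cnj z * of_real ?s = z * of_real ?s" unfolding q by simp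
  moreover have "?s \<noteq> 0"
  proof
    assume "?s = 0"
    then have "w $ i = 0" if "i < n" for i using that by (subst (asm) sum_nonneg_eq_0_iff) auto
    then show False using w by (auto intro!: eq_vecI)
  qed
  ultimately have "cnj z = z" by (metis mult_cancel_right of_real_eq_0_iff)
  then have z: "z = of_real (Re z)" by (simp add: complex_eq_iff)
  have re: "A *\<^sub>v map_vec Re w = Re z \<cdot>\<^sub>v map_vec Re w"
  proof (rule eq_vecI)
    fix i assume "i < dim_vec (Re z \<cdot>\<^sub>v map_vec Re w)"
    then have i: "i < n" using w by simp
    have "Re (\<Sum>j<n. of_real (A $$ (i, j)) * w $ j) = Re z * Re (w $ i)"
      unfolding eq[OF i] by (subst z) simp
    then show "(A *\<^sub>v map_vec Re w) $ i = (Re z \<cdot>\<^sub>v map_vec Re w) $ i"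
      using A w i by (subst mult_mat_vec_sum[OF A]) auto
  qed (use A w in auto)
  have im: "A *\<^sub>v map_vec Im w = Re z \<cdot>\<^sub>v map_vec Im w"
  proof (rule eq_vecI)
    fix i assume "i < dim_vec (Re z \<cdot>\<^sub>v map_vec Im w)"
    then have i: "i < n" using w by simp
    have "Im (\<Sum>j<n. of_real (A $$ (i, j)) * w $ j) = Re z * Im (w $ i)"
      unfolding eq[OF i] by (subst z) simp
    then show "(A *\<^sub>v map_vec Im w) $ i = (Re z \<cdot>\<^sub>v map_vec Im w) $ i"
      using A w i by (subst mult_mat_vec_sum[OF A]) auto
  qed (use A w in auto)
  have "map_vec Re w \<noteq> 0\<^sub>v n \<or> map_vec Im w \<noteq> 0\<^sub>v n"
  proof (rule ccontr)
    assume "\<not> ?thesis"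
    then have *: "map_vec Re w = 0\<^sub>v n" "map_vec Im w = 0\<^sub>v n" by auto
    have "w $ i = 0" if "i < n" for i
      using arg_cong[OF *(1), of "\<lambda>v. v $ i"] arg_cong[OF *(2), of "\<lambda>v. v $ i"] that w(1)
      by (simp add: complex_eq_iff)
    then show False using w by (auto intro!: eq_vecI)
  qed
  then show ?thesis
    using that[of "map_vec Re w" "Re z"] that[of "map_vec Im w" "Re z"] re im w(1) by auto
qed

text \<open>The reflection that exchanges \<open>v\<close> and the first unit vector e0, along their
  difference \<open>u\<close>. It is symmetric and its own inverse, so it conjugates symmetric
  matrices to symmetric ones. If \<open>v\<close> equals e0 the difference is 0 and the identity
  serves.\<close>

lemma householder:
  fixes v :: "real vec"
  assumes v: "v \<in> carrier_vec (Suc n)" and norm: "v \<bullet> v = 1"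
  obtains H where "H \<in> carrier_mat (Suc n) (Suc n)" "transpose_mat H = H" "H * H = 1\<^sub>m (Suc n)"
    "H *\<^sub>v unit_vec (Suc n) 0 = v"
proof (cases "v = unit_vec (Suc n) 0")
  case True
  then show ?thesis using that[of "1\<^sub>m (Suc n)"] by simp
next
  case False
  let ?N = "Suc n"
  define u where "u i = v $ i - (if i = 0 then 1 else 0)" for i
  define s where "s = (\<Sum>i<?N. u i * u i)"
  define c where "c = 2 / s"
  define H where "H = mat ?N ?N (\<lambda>(i, j). (if i = j then 1 else 0) - c * u i * u j)"
  have H: "H \<in> carrier_mat ?N ?N" by (simp add: H_def)
  have "s \<noteq> 0"
  proof
    assume "s = 0"
    then have "u i = 0" if "i < ?N" for i
      using that unfolding s_def by (subst (asm) sum_nonneg_eq_0_iff) auto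
    then show False using False v by (auto intro!: eq_vecI simp: u_def)
  qed
  then have cs: "c * s = 2" by (simp add: c_def)
  have vv: "(\<Sum>i<?N. v $ i * v $ i) = 1"
    using norm v by (simp add: scalar_prod_def lessThan_atLeast0)
  have "s = (\<Sum>i<?N. v $ i * v $ i - 2 * (if i = 0 then v $ i else 0) + (if i = 0 then 1 else 0))"
    unfolding s_def u_def by (intro sum.cong refl) (auto simp: algebra_simps)
  also have "\<dots> = 1 - 2 * v $ 0 + 1"
    unfolding sum.distrib sum_subtractf vv sum_distrib_left[symmetric] by simp
  \<comment> \<open>Both vectors have length 1, so their squared distance is 2 - 2 v_0. This gives
    \<open>c * u 0 = - 1\<close>, and the reflection sends e0 to e0 + u, which is
    \<open>v\<close>.\<close>
  finally have s: "s = - 2 * u 0" by (simp add: u_def)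
  then have cu: "c * u 0 = - 1" using cs \<open>s \<noteq> 0\<close> by (simp add: field_simps)
  have "transpose_mat H = H" by (rule eq_matI) (auto simp: H_def)
  moreover have "H * H = 1\<^sub>m ?N"
  proof (rule eq_matI)
    fix i j assume "i < dim_row (1\<^sub>m ?N :: real mat)" "j < dim_col (1\<^sub>m ?N :: real mat)"
    then have ij: "i < ?N" "j < ?N" by auto
    have "(H * H) $$ (i, j) = (\<Sum>l<?N. ((if i = l then 1 else 0) - c * u i * u l) * ((if l = j then 1 else 0) - c * u l * u j))"
      using ij by (simp add: H_def scalar_prod_def lessThan_atLeast0)
    also have "\<dots> = (\<Sum>l<?N. (if l = i then (if i = j then 1 else 0) - c * u i * u j else 0)
        - (if l = j then c * u i * u j else 0) + c * c * u i * u j * (u l * u l))"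
      by (intro sum.cong refl) (auto simp: algebra_simps)
    also have "\<dots> = (if i = j then 1 else 0) - c * u i * u j - c * u i * u j + c * c * u i * u j * s"
      unfolding s_def sum.distrib sum_subtractf sum_distrib_left[symmetric] using ij by simp
    also have "c * c * u i * u j * s = (c * s) * (c * u i * u j)" by (simp add: mult_ac)
    finally show "(H * H) $$ (i, j) = 1\<^sub>m ?N $$ (i, j)" using ij unfolding cs by simp
  qed (simp_all add: H_def)
  moreover have "H *\<^sub>v unit_vec ?N 0 = v"
  proof (rule eq_vecI)
    fix i assume "i < dim_vec v"
    then have i: "i < ?N" using v by simp
    have "(H *\<^sub>v unit_vec ?N 0) $ i = (\<Sum>j<?N. H $$ (i, j) * unit_vec ?N 0 $ j)"
      using H i by (intro mult_mat_vec_sum) auto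
    also have "\<dots> = (\<Sum>j<?N. if j = 0 then H $$ (i, 0) else 0)"
      by (intro sum.cong refl) auto
    also have "\<dots> = H $$ (i, 0)" by (subst sum.delta) auto
    also have "\<dots> = (if i = 0 then 1 else 0) - u i * (c * u 0)"
      using i by (simp add: H_def mult_ac)
    also have "\<dots> = v $ i" unfolding cu by (simp add: u_def)
    finally show "(H *\<^sub>v unit_vec ?N 0) $ i = v $ i" .
  qed (use v H in auto)
  ultimately show ?thesis using that H by blast
qed

text \<open>Deflation: conjugation by a Householder reflection moves an eigenvector to the first
  unit vector. The first column, and by symmetry the first row, then vanish off the diagonal,
  leaving a smaller symmetric block for the induction.\<close>

theorem real_symmetric_spectral:
  fixes A :: "real mat"
  assumes "A \<in> carrier_mat n n" "transpose_mat A = A"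
  obtains U d where "U \<in> carrier_mat n n" "transpose_mat U * U = 1\<^sub>m n"
    "A = U * mat_diag n d * transpose_mat U"
  using assms
proof (induction n arbitrary: A thesis)
  case 0
  show ?case by (rule 0(1)[of "1\<^sub>m 0" "\<lambda>_. 0"]) (use 0 in auto)
next
  case (Suc n)
  let ?N = "Suc n"
  note A = Suc.prems(2) and sym = Suc.prems(3)
  obtain e v0 where v0: "v0 \<in> carrier_vec ?N" "v0 \<noteq> 0\<^sub>v ?N" "A *\<^sub>v v0 = e \<cdot>\<^sub>v v0"
    using real_symmetric_eigenvector[OF A sym] by blast
  have pos: "0 < v0 \<bullet> v0"
    using v0 conjugate_square_greater_0_vec[of v0 ?N] by simp
  define v where "v = (1 / sqrt (v0 \<bullet> v0)) \<cdot>\<^sub>v v0"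
  have v: "v \<in> carrier_vec ?N" "v \<bullet> v = 1" "A *\<^sub>v v = e \<cdot>\<^sub>v v"
    using v0 pos A by (auto simp: v_def mult_mat_vec smult_smult_assoc mult.commute)
  obtain H where H: "H \<in> carrier_mat ?N ?N" "transpose_mat H = H" "H * H = 1\<^sub>m ?N"
      "H *\<^sub>v unit_vec ?N 0 = v"
    using householder[OF v(1,2)] by blast
  define C where "C = H * A * H"
  have C: "C \<in> carrier_mat ?N ?N" using H A by (simp add: C_def)
  have C_sym: "transpose_mat C = C"
  proof -
    have "transpose_mat C = transpose_mat H * transpose_mat (H * A)"
      unfolding C_def using H(1) A by (intro transpose_mult) auto
    also have "transpose_mat (H * A) = transpose_mat A * transpose_mat H"
      using H(1) A by (rule transpose_mult)
    finally show ?thesis using H A sym by (simp add: C_def assoc_mult_mat)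
  qed
  have HCH: "A = H * C * H"
  proof -
    have "H * C * H = H * (H * A * H) * H" by (simp add: C_def)
    also have "\<dots> = (H * H) * A * (H * H)" using H(1) A by (simp add: assoc_mult_mat[of _ ?N ?N _ ?N _ ?N])
    finally show ?thesis using H(3) A by simp
  qed
  have Hv: "H *\<^sub>v v = unit_vec ?N 0"
  proof -
    have "H *\<^sub>v v = (H * H) *\<^sub>v unit_vec ?N 0"
      unfolding H(4)[symmetric] using H(1) by (simp add: assoc_mult_mat_vec[of _ ?N ?N _ ?N])
    then show ?thesis using H(3) by simp
  qed
  have "C *\<^sub>v unit_vec ?N 0 = H *\<^sub>v (A *\<^sub>v v)"
    using H A by (simp add: C_def assoc_mult_mat_vec[of _ ?N ?N _ ?N])
  also have "\<dots> = e \<cdot>\<^sub>v unit_vec ?N 0"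
    using v(1,3) H(1) Hv by (simp add: mult_mat_vec)
  finally have C0: "C *\<^sub>v unit_vec ?N 0 = e \<cdot>\<^sub>v unit_vec ?N 0" .
  have col: "C $$ (i, 0) = (if i = 0 then e else 0)" if "i < ?N" for i
  proof -
    have "(C *\<^sub>v unit_vec ?N 0) $ i = (\<Sum>j<?N. C $$ (i, j) * unit_vec ?N 0 $ j)"
      using C that by (intro mult_mat_vec_sum) auto
    also have "\<dots> = (\<Sum>j<?N. if j = 0 then C $$ (i, 0) else 0)"
      by (intro sum.cong refl) auto
    also have "\<dots> = C $$ (i, 0)" by (subst sum.delta) auto
    finally show ?thesis unfolding C0 using that by (cases "i = 0") auto
  qed
  have row: "C $$ (0, i) = (if i = 0 then e else 0)" if "i < ?N" for i
    using col[OF that] C_sym C that by (metis carrier_matD index_transpose_mat(1) zero_less_Suc)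
  define D where "D = mat n n (\<lambda>(i, j). C $$ (Suc i, Suc j))"
  have D: "D \<in> carrier_mat n n" by (simp add: D_def)
  have "transpose_mat D = D"
  proof (rule eq_matI)
    fix i j assume "i < dim_row D" "j < dim_col D"
    then have ij: "Suc i < ?N" "Suc j < ?N" by (auto simp: D_def)
    have "C $$ (Suc j, Suc i) = C $$ (Suc i, Suc j)"
      using C_sym C ij by (metis carrier_matD index_transpose_mat(1))
    then show "transpose_mat D $$ (i, j) = D $$ (i, j)" using ij by (simp add: D_def)
  qed (auto simp: D_def)
  then obtain U d where U: "U \<in> carrier_mat n n" "transpose_mat U * U = 1\<^sub>m n"
      "D = U * mat_diag n d * transpose_mat U"
    using Suc.IH[OF _ D] by blast
  let ?b = "\<lambda>E F. four_block_mat (E :: real mat) (0\<^sub>m 1 n) (0\<^sub>m n 1) F"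
  let ?E = "mat 1 1 (\<lambda>_. e)"
  define V where "V = ?b (1\<^sub>m 1) U"
  have V: "V \<in> carrier_mat ?N ?N" using U by (auto simp: V_def)
  have VT: "transpose_mat V = ?b (1\<^sub>m 1) (transpose_mat U)"
    unfolding V_def using U by (subst transpose_four_block_mat) auto
  have mult: "?b E F * ?b E' F' = ?b (E * E') (F * F')"
    if "E \<in> carrier_mat 1 1" "E' \<in> carrier_mat 1 1" "F \<in> carrier_mat n n" "F' \<in> carrier_mat n n" for E E' F F'
    using that by (subst mult_four_block_mat[of _ 1 1 _ n _ n _ _ 1 _ n]) auto
  have VV: "transpose_mat V * V = 1\<^sub>m ?N"
    unfolding VT unfolding V_def using U by (subst mult) auto
  have diag: "mat_diag ?N (case_nat e d) = ?b ?E (mat_diag n d)"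
    by (rule eq_matI) (auto simp: mat_diag_def split: nat.split)
  have "C = ?b ?E D"
    using C col row by (intro eq_matI) (auto simp: D_def)
  also have "\<dots> = V * mat_diag ?N (case_nat e d) * transpose_mat V"
    unfolding VT diag unfolding V_def U(3) using U(1)
    by (subst mult, simp, simp, simp, simp, subst mult) auto
  finally have CV: "C = V * mat_diag ?N (case_nat e d) * transpose_mat V" .
  have HV: "transpose_mat (H * V) = transpose_mat V * H"
    using transpose_mult[OF H(1) V] H(2) by simp
  show ?case
  proof (rule Suc.prems(1)[of "H * V" "case_nat e d"])
    show "H * V \<in> carrier_mat ?N ?N" using H V by simp
    have "transpose_mat (H * V) * (H * V) = transpose_mat V * (H * H) * V"
      unfolding HV using H(1) V by (simp add: assoc_mult_mat[of _ ?N ?N _ ?N _ ?N])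
    then show "transpose_mat (H * V) * (H * V) = 1\<^sub>m ?N" using H(3) V VV by simp
    have assoc: "H * (V * E * F) * H = H * V * E * (F * H)"
      if "E \<in> carrier_mat ?N ?N" "F \<in> carrier_mat ?N ?N" for E F
      using that H(1) V by (simp add: assoc_mult_mat[of _ ?N ?N _ ?N _ ?N])
    show "A = H * V * mat_diag ?N (case_nat e d) * transpose_mat (H * V)"
      unfolding HV by (subst HCH, subst CV, rule assoc[OF mat_diag_dim]) (use V in simp)
  qed
qed

text \<open>The vectors become rows of a square matrix completed by zero rows; its determinant is 0,
  so it has a nonzero kernel vector.\<close>

lemma exists_nonzero_orthogonal:
  fixes S :: "real vec set"
  assumes "finite S" "S \<subseteq> carrier_vec n" "card S < n"
  shows "\<exists>x\<in>carrier_vec n. x \<noteq> 0\<^sub>v n \<and> (\<forall>s\<in>S. s \<bullet> x = 0)"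
proof -
  obtain g where g: "bij_betw g {0..<card S} S"
    using ex_bij_betw_nat_finite[OF assms(1)] by blast
  define c where "c i = (if i < card S then g i else 0\<^sub>v n)" for i
  define R where "R = mat\<^sub>r n n (\<lambda>i. if i = card S then 0\<^sub>v n else c i)"
  have c: "c i \<in> carrier_vec n" for i
    using g assms(2) by (auto simp: c_def bij_betw_def)
  then have "det R = 0" unfolding R_def using assms(3) by (intro det_row_0) auto
  moreover have "R \<in> carrier_mat n n" by (simp add: R_def)
  ultimately obtain x where x: "x \<in> carrier_vec n" "x \<noteq> 0\<^sub>v n" "R *\<^sub>v x = 0\<^sub>v n"
    using det_0_iff_vec_prod_zero by blast
  have "s \<bullet> x = 0" if "s \<in> S" for s
  proof -
    have "s \<in> g ` {0..<card S}" using g that by (simp add: bij_betw_def)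
    then obtain i where i: "i < card S" "s = g i" by auto
    have "(R *\<^sub>v x) $ i = 0" using x i assms(3) by simp
    moreover have "row R i = s"
      using i assms(3) c[of i] unfolding R_def by (subst row_mat_of_row_fun) (auto simp: c_def)
    ultimately show ?thesis using i assms(3) by (simp add: R_def)
  qed
  then show ?thesis using x by blast
qed

section \<open>Quadratic forms and traces in an eigenbasis\<close>

lemma orthogonal_mult_transpose:
  fixes U :: "real mat"
  assumes U: "U \<in> carrier_mat n n" and orth: "transpose_mat U * U = 1\<^sub>m n"
  shows "U * transpose_mat U = 1\<^sub>m n"
  using mat_mult_left_right_inverse[of "transpose_mat U" n U] U orth by simp

lemma orthogonal_norm:
  fixes U :: "real mat"
  assumes U: "U \<in> carrier_mat n n" and orth: "transpose_mat U * U = 1\<^sub>m n"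
    and x: "x \<in> carrier_vec n"
  shows "x \<bullet> x = (\<Sum>i<n. (col U i \<bullet> x)\<^sup>2)"
proof -
  have "(transpose_mat U *\<^sub>v x) \<bullet> (transpose_mat U *\<^sub>v x) = x \<bullet> (U *\<^sub>v (transpose_mat U *\<^sub>v x))"
    using U x by (intro transpose_vec_mult_scalar) auto
  also have "U *\<^sub>v (transpose_mat U *\<^sub>v x) = x"
    using U x orthogonal_mult_transpose[OF U orth] by (simp flip: assoc_mult_mat_vec[of _ n n _ n])
  finally show ?thesis
    using U by (simp add: scalar_prod_def[of "transpose_mat U *\<^sub>v x"] lessThan_atLeast0 power2_eq_square)
qed

context
  fixes A U :: "real mat" and n :: nat and d :: "nat \<Rightarrow> real"
  assumes U: "U \<in> carrier_mat n n" and orth: "transpose_mat U * U = 1\<^sub>m n"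
    and A: "A = U * mat_diag n d * transpose_mat U"
begin

lemma spectral_form:
  assumes x: "x \<in> carrier_vec n"
  shows "x \<bullet> (A *\<^sub>v x) = (\<Sum>i<n. d i * (col U i \<bullet> x)\<^sup>2)"
proof -
  let ?y = "transpose_mat U *\<^sub>v x"
  have y: "?y \<in> carrier_vec n" using U x by simp
  have "A *\<^sub>v x = U *\<^sub>v (mat_diag n d *\<^sub>v ?y)"
    unfolding A using U x by (simp add: assoc_mult_mat_vec[of _ n n _ n])
  moreover have "?y \<bullet> (mat_diag n d *\<^sub>v ?y) = x \<bullet> (U *\<^sub>v (mat_diag n d *\<^sub>v ?y))"
    using U x mult_mat_vec_carrier[OF mat_diag_dim y] by (intro transpose_vec_mult_scalar)
  ultimately have "x \<bullet> (A *\<^sub>v x) = ?y \<bullet> (mat_diag n d *\<^sub>v ?y)" by simp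
  also have "\<dots> = (\<Sum>i<n. ?y $ i * (mat_diag n d *\<^sub>v ?y) $ i)"
  proof -
    have "dim_vec (mat_diag n d *\<^sub>v ?y) = n" by (simp add: carrier_matD[OF mat_diag_dim])
    then show ?thesis by (simp only: scalar_prod_def lessThan_atLeast0)
  qed
  also have "\<dots> = (\<Sum>i<n. d i * (?y $ i)\<^sup>2)"
  proof (intro sum.cong refl)
    fix i assume "i \<in> {..<n}"
    then have i: "i < n" by simp
    have "(mat_diag n d *\<^sub>v ?y) $ i = (\<Sum>j<n. mat_diag n d $$ (i, j) * ?y $ j)"
      using y i by (intro mult_mat_vec_sum) auto
    also have "\<dots> = (\<Sum>j<n. if j = i then d i * ?y $ i else 0)"
      using i by (intro sum.cong refl) (auto simp: mat_diag_def)
    also have "\<dots> = d i * ?y $ i" using i by simp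
    finally show "?y $ i * (mat_diag n d *\<^sub>v ?y) $ i = d i * (?y $ i)\<^sup>2"
      by (simp add: power2_eq_square)
  qed
  also have "\<dots> = (\<Sum>i<n. d i * (col U i \<bullet> x)\<^sup>2)"
    using U by (intro sum.cong refl) auto
  finally show ?thesis .
qed

lemma spectral_similar: "similar_mat_wit A (mat_diag n d) U (transpose_mat U)"
  using U orth orthogonal_mult_transpose[OF U orth] A by (intro similar_mat_witI[of _ _ n]) auto

lemma spectral_proots: "proots (char_poly A) = image_mset d (mset_set {..<n})"
proof -
  have "char_poly A = char_poly (mat_diag n d)"
    using spectral_similar by (intro char_poly_similar) (auto simp: similar_mat_def)
  also have "\<dots> = (\<Prod>a\<leftarrow>diag_mat (mat_diag n d). [:- a, 1:])"
    by (rule char_poly_upper_triangular[of _ n]) (auto simp: mat_diag_def)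
  also have "diag_mat (mat_diag n d) = map d [0..<n]"
    by (auto simp: diag_mat_def mat_diag_def)
  finally have "char_poly A = (\<Prod>a\<leftarrow>map d [0..<n]. [:- a, 1:])" .
  moreover have "proots (\<Prod>a\<leftarrow>as. [:- a, 1:]) = mset as" for as :: "real list"
  proof (induction as)
    case (Cons a as)
    have "(\<Prod>a\<leftarrow>as. [:- a, 1:]) \<noteq> 0" by (auto simp: prod_list_zero_iff)
    then have "proots ([:- a, 1:] * (\<Prod>a\<leftarrow>as. [:- a, 1:])) = proots [:- a, 1:] + proots (\<Prod>a\<leftarrow>as. [:- a, 1:])"
      by (intro proots_mult) auto
    then show ?case using Cons.IH by (simp del: mult_pCons_left)
  qed simp
  ultimately have "proots (char_poly A) = mset (map d [0..<n])" by (simp only:)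
  then show ?thesis by (simp add: lessThan_atLeast0)
qed

lemma mat_diag_pow: "mat_diag n d ^\<^sub>m m = mat_diag n (\<lambda>i. d i ^ m)"
  by (induction m) (auto simp: mult.commute carrier_matD[OF mat_diag_dim])

lemma spectral_power_sum: "(\<Sum>i<n. d i ^ m) = (\<Sum>i<n. (A ^\<^sub>m m) $$ (i, i))"
proof -
  have "A ^\<^sub>m m = U * mat_diag n (\<lambda>i. d i ^ m) * transpose_mat U"
    using similar_mat_wit_pow_id[OF spectral_similar, of m] by (simp add: mat_diag_pow)
  also have "U * mat_diag n (\<lambda>i. d i ^ m) = mat n n (\<lambda>(i, j). U $$ (i, j) * d j ^ m)"
    using U by (rule mat_diag_mult_right)
  finally have "(A ^\<^sub>m m) $$ (i, i) = (\<Sum>j<n. U $$ (i, j) * d j ^ m * U $$ (i, j))" if "i < n" for i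
    using that U by (simp add: scalar_prod_def lessThan_atLeast0)
  then have "(\<Sum>i<n. (A ^\<^sub>m m) $$ (i, i)) = (\<Sum>i<n. \<Sum>j<n. U $$ (i, j) * d j ^ m * U $$ (i, j))"
    by simp
  also have "\<dots> = (\<Sum>j<n. \<Sum>i<n. U $$ (i, j) * d j ^ m * U $$ (i, j))" by (rule sum.swap)
  also have "\<dots> = (\<Sum>j<n. d j ^ m * (transpose_mat U * U) $$ (j, j))"
    using U by (intro sum.cong refl) (simp add: scalar_prod_def lessThan_atLeast0 sum_distrib_left mult_ac)
  also have "\<dots> = (\<Sum>j<n. d j ^ m)" using orth by simp
  finally show ?thesis by simp
qed

end

text \<open>A nonzero vector in the span of the eigenvectors of \<open>A\<close> with eigenvalue at most \<open>t\<close>,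
  orthogonal to those of \<open>B\<close> and to \<open>K\<close>, would have contradictory quadratic forms.\<close>
lemma card_eigenvalues_le:
  fixes A B U V :: "real mat"
  assumes U: "U \<in> carrier_mat n n" "transpose_mat U * U = 1\<^sub>m n" "A = U * mat_diag n d * transpose_mat U"
    and V: "V \<in> carrier_mat n n" "transpose_mat V * V = 1\<^sub>m n" "B = V * mat_diag n f * transpose_mat V"
    and K: "finite K" "K \<subseteq> carrier_vec n"
    and eq: "\<And>x. x \<in> carrier_vec n \<Longrightarrow> (\<And>s. s \<in> K \<Longrightarrow> s \<bullet> x = 0) \<Longrightarrow> x \<bullet> (A *\<^sub>v x) = x \<bullet> (B *\<^sub>v x)"
  shows "card {i\<in>{..<n}. d i \<le> t} \<le> card {i\<in>{..<n}. f i \<le> t} + card K"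
proof (rule ccontr)
  assume less: "\<not> ?thesis"
  let ?P = "{i\<in>{..<n}. d i \<le> t}" and ?Q = "{i\<in>{..<n}. f i \<le> t}"
  let ?S = "col U ` ({..<n} - ?P) \<union> col V ` ?Q \<union> K"
  \<comment> \<open>\<open>?S\<close> collects the linear conditions on the test vector; if the
    claim fails there are fewer than \<open>n\<close> of them, so a nonzero solution exists.\<close>
  have "card ?S \<le> card ({..<n} - ?P) + card ?Q + card K"
  proof -
    have "card ?S \<le> card (col U ` ({..<n} - ?P) \<union> col V ` ?Q) + card K" by (rule card_Un_le)
    moreover have "card (col U ` ({..<n} - ?P) \<union> col V ` ?Q) \<le> card (col U ` ({..<n} - ?P)) + card (col V ` ?Q)"
      by (rule card_Un_le)
    moreover have "card (col U ` ({..<n} - ?P)) \<le> card ({..<n} - ?P)" by (rule card_image_le) simp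
    moreover have "card (col V ` ?Q) \<le> card ?Q" by (rule card_image_le) simp
    ultimately show ?thesis by linarith
  qed
  moreover have "card ({..<n} - ?P) = n - card ?P" by (subst card_Diff_subset) auto
  moreover have "card ?P \<le> n" using card_mono[of "{..<n}" ?P] by auto
  ultimately have card: "card ?S < n" using less by linarith
  have "finite ?S" using K(1) by simp
  moreover have "?S \<subseteq> carrier_vec n"
    using K(2) col_carrier_vec[OF _ U(1)] col_carrier_vec[OF _ V(1)] by (intro Un_least image_subsetI) auto
  ultimately have "\<exists>x\<in>carrier_vec n. x \<noteq> 0\<^sub>v n \<and> (\<forall>s\<in>?S. s \<bullet> x = 0)"
    using card by (rule exists_nonzero_orthogonal)
  then obtain x where x: "x \<in> carrier_vec n" "x \<noteq> 0\<^sub>v n" "\<forall>s\<in>?S. s \<bullet> x = 0"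
    by (elim bexE conjE)
  have pos: "0 < x \<bullet> x" using x conjugate_square_greater_0_vec[of x n] by simp
  have "x \<bullet> (A *\<^sub>v x) \<le> t * (x \<bullet> x)"
    unfolding spectral_form[OF U x(1)] orthogonal_norm[OF U(1,2) x(1)] sum_distrib_left
  proof (rule sum_mono)
    fix i assume i: "i \<in> {..<n}"
    show "d i * (col U i \<bullet> x)\<^sup>2 \<le> t * (col U i \<bullet> x)\<^sup>2"
    proof (cases "d i \<le> t")
      case False
      then have "col U i \<bullet> x = 0" using i by (intro bspec[OF x(3)] UnI1 imageI) simp
      then show ?thesis by simp
    qed (simp add: mult_right_mono)
  qed
  moreover have "t * (x \<bullet> x) < x \<bullet> (B *\<^sub>v x)"
    unfolding spectral_form[OF V x(1)] orthogonal_norm[OF V(1,2) x(1)] sum_distrib_left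
  proof (rule sum_strict_mono_ex1)
    have zero: "col V i \<bullet> x = 0" if "i < n" "f i \<le> t" for i
      using that by (intro bspec[OF x(3)] UnI1[OF UnI2] imageI) simp
    show "\<forall>i\<in>{..<n}. t * (col V i \<bullet> x)\<^sup>2 \<le> f i * (col V i \<bullet> x)\<^sup>2"
    proof
      fix i assume i: "i \<in> {..<n}"
      show "t * (col V i \<bullet> x)\<^sup>2 \<le> f i * (col V i \<bullet> x)\<^sup>2"
      proof (cases "f i \<le> t")
        case True
        then show ?thesis using zero i by simp
      qed (simp add: mult_right_mono)
    qed
    \<comment> \<open>The nonzero \<open>x\<close> has a nonzero coordinate in the eigenbasis of
      \<open>B\<close>. By the choice of \<open>x\<close> its eigenvalue exceeds \<open>t\<close>,
      which makes the inequality strict.\<close>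
    have "\<exists>i<n. col V i \<bullet> x \<noteq> 0"
    proof (rule ccontr)
      assume "\<not> ?thesis"
      then have "x \<bullet> x = 0" unfolding orthogonal_norm[OF V(1,2) x(1)] by (intro sum.neutral) auto
      then show False using pos by simp
    qed
    then obtain i where i: "i < n" "col V i \<bullet> x \<noteq> 0" by blast
    then have "t < f i" using zero[of i] by linarith
    then have "t * (col V i \<bullet> x)\<^sup>2 < f i * (col V i \<bullet> x)\<^sup>2"
      using i by (intro mult_strict_right_mono) auto
    then show "\<exists>i\<in>{..<n}. t * (col V i \<bullet> x)\<^sup>2 < f i * (col V i \<bullet> x)\<^sup>2"
      using i(1) by blast
  qed simp
  moreover have "x \<bullet> (A *\<^sub>v x) = x \<bullet> (B *\<^sub>v x)"
    by (rule eq[OF x(1)], rule bspec[OF x(3)], rule UnI2)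
  ultimately show False by simp
qed

subsection \<open>Spectral measures of checkerboard matrices\<close>

lemma pow_mat_Suc_left:
  assumes "A \<in> carrier_mat n n"
  shows "A ^\<^sub>m Suc m = A * A ^\<^sub>m m"
proof (induction m)
  case 0
  then show ?case using assms by simp
next
  case (Suc m)
  have "A ^\<^sub>m Suc (Suc m) = A * A ^\<^sub>m m * A" using Suc by simp
  also have "\<dots> = A * (A ^\<^sub>m m * A)"
    using assms by (intro assoc_mult_mat) auto
  finally show ?case by simp
qed

text \<open>Both endpoints are free because the induction over matrix powers moves the starting
  point; closed walks are the case \<open>r = s\<close>.\<close>

definition paths :: "nat \<Rightarrow> nat \<Rightarrow> nat \<Rightarrow> nat \<Rightarrow> nat \<Rightarrow> nat list set" where
  "paths k N n r s = {w. length w = Suc n \<and> set w \<subseteq> {..<N} \<and> hd w = r \<and> last w = s \<and> (\<forall>e\<in>set (ledges w). allowed k e)}"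

lemma finite_paths [simp]: "finite (paths k N n r s)"
  by (rule finite_subset[OF _ finite_lists_length_eq[of "{..<N}" "Suc n"]]) (auto simp: paths_def)

lemma paths_0: "r < N \<Longrightarrow> paths k N 0 r s = (if r = s then {[r]} else {})"
  by (auto simp: paths_def length_Suc_conv)

lemma paths_Suc:
  assumes "r < N"
  shows "paths k N (Suc n) r s = (\<Union>x\<in>{x. x < N \<and> r mod k \<noteq> x mod k}. (#) r ` paths k N n x s)"
proof (intro Set.set_eqI iffI)
  fix w assume w: "w \<in> paths k N (Suc n) r s"
  then obtain x l where w_eq: "w = r # x # l"
    by (auto simp: paths_def length_Suc_conv)
  then have "x # l \<in> paths k N n x s" "x < N" "r mod k \<noteq> x mod k"
    using w by (auto simp: paths_def)
  then show "w \<in> (\<Union>x\<in>{x. x < N \<and> r mod k \<noteq> x mod k}. (#) r ` paths k N n x s)"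
    using w_eq by auto
next
  fix w assume "w \<in> (\<Union>x\<in>{x. x < N \<and> r mod k \<noteq> x mod k}. (#) r ` paths k N n x s)"
  then obtain x l where x: "x < N" "r mod k \<noteq> x mod k" "w = r # l" "l \<in> paths k N n x s" by auto
  then obtain l' where "l = x # l'" by (auto simp: paths_def length_Suc_conv)
  then show "w \<in> paths k N (Suc n) r s" using x assms by (auto simp: paths_def)
qed

lemma walks_eq_paths: "walks k N n = (\<Union>r<N. paths k N n r r)"
  by (auto simp: walks_def paths_def length_Suc_conv)

context
  fixes A :: "real mat" and b :: "nat \<times> nat \<Rightarrow> real" and k N :: nat
  assumes A: "A = mat N N (\<lambda>(i, j). if i mod k = j mod k then 0 else b (edge i j))"
begin

lemma pow_mat_eq_sum_paths:
  assumes "r < N" "s < N"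
  shows "(A ^\<^sub>m n) $$ (r, s) = (\<Sum>w\<in>paths k N n r s. prod_list (map b (ledges w)))"
  using assms(1)
proof (induction n arbitrary: r)
  case 0
  then show ?case using assms(2) A by (simp add: paths_0)
next
  case (Suc n)
  have carrier: "A \<in> carrier_mat N N" by (simp add: A)
  let ?X = "{x. x < N \<and> r mod k \<noteq> x mod k}"
  have "(A ^\<^sub>m Suc n) $$ (r, s) = (\<Sum>x<N. A $$ (r, x) * (A ^\<^sub>m n) $$ (x, s))"
    unfolding pow_mat_Suc_left[OF carrier]
    using carrier pow_carrier_mat[OF carrier, of n] Suc.prems assms(2)
    by (simp add: scalar_prod_def lessThan_atLeast0)
  also have "\<dots> = (\<Sum>x<N. if r mod k = x mod k then 0 else b (edge r x) * (\<Sum>w\<in>paths k N n x s. prod_list (map b (ledges w))))"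
    using Suc by (intro sum.cong refl) (auto simp: A)
  also have "\<dots> = (\<Sum>x\<in>?X. b (edge r x) * (\<Sum>w\<in>paths k N n x s. prod_list (map b (ledges w))))"
    by (intro sum.mono_neutral_cong_right) auto
  also have "\<dots> = (\<Sum>x\<in>?X. \<Sum>w\<in>(#) r ` paths k N n x s. prod_list (map b (ledges w)))"
  proof (intro sum.cong refl)
    fix x
    have "prod_list (map b (ledges (r # w))) = b (edge r x) * prod_list (map b (ledges w))"
      if "w \<in> paths k N n x s" for w
      using that by (auto simp: paths_def length_Suc_conv)
    then show "b (edge r x) * (\<Sum>w\<in>paths k N n x s. prod_list (map b (ledges w))) =
        (\<Sum>w\<in>(#) r ` paths k N n x s. prod_list (map b (ledges w)))"
      by (simp add: sum.reindex sum_distrib_left)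
  qed
  also have "\<dots> = (\<Sum>w\<in>(\<Union>x\<in>?X. (#) r ` paths k N n x s). prod_list (map b (ledges w)))"
    by (rule sum.UNION_disjoint[symmetric], simp, simp) (auto simp: paths_def)
  also have "\<dots> = (\<Sum>w\<in>paths k N (Suc n) r s. prod_list (map b (ledges w)))"
    using paths_Suc[OF Suc.prems] by simp
  finally show ?case .
qed

lemma trace_pow_mat_eq_sum_walks:
  "(\<Sum>r<N. (A ^\<^sub>m n) $$ (r, r)) = (\<Sum>w\<in>walks k N n. prod_list (map b (ledges w)))"
proof -
  have "(\<Sum>r<N. (A ^\<^sub>m n) $$ (r, r)) = (\<Sum>r<N. \<Sum>w\<in>paths k N n r r. prod_list (map b (ledges w)))"
    by (intro sum.cong refl pow_mat_eq_sum_paths) auto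
  also have "\<dots> = (\<Sum>w\<in>(\<Union>r<N. paths k N n r r). prod_list (map b (ledges w)))"
    by (rule sum.UNION_disjoint[symmetric], simp, simp) (auto simp: paths_def)
  finally show ?thesis by (simp add: walks_eq_paths)
qed

end

text \<open>This includes \<open>N = 0\<close>: the empty matrix has no eigenvalues, and
  \<open>pmf_of_multiset\<close> of the empty multiset is an unspecified probability mass function.
  It may lack moments, so the moment formulas assume \<open>0 < N\<close>.\<close>

lemma real_distribution_empirical: "real_distribution (empirical_spectral_measure N A)"
  unfolding empirical_spectral_measure_def
  by (rule prob_space.real_distribution_distr[OF prob_space_measure_pmf]) simp

text \<open>A uniformly chosen index accounts for multiplicities and turns moments and distribution
  functions into finite averages over \<open>d\<close>.\<close>

lemma empirical_eq_distr:
  assumes "0 < N" and "proots (char_poly A) = image_mset d (mset_set {..<N})"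
  shows "empirical_spectral_measure N A =
    distr (measure_pmf (pmf_of_set {..<N})) borel (\<lambda>i. d i / sqrt (real N))"
proof -
  let ?f = "\<lambda>i. d i / sqrt (real N)"
  have "image_mset (\<lambda>l. l / sqrt (real N)) (proots (char_poly A)) = image_mset ?f (mset_set {..<N})"
    unfolding assms(2) by (simp add: image_mset.compositionality o_def)
  then have "empirical_spectral_measure N A = distr (measure_pmf (map_pmf ?f (pmf_of_set {..<N}))) borel (\<lambda>x. x)"
    unfolding empirical_spectral_measure_def using assms(1)
    by (subst map_pmf_of_set) (auto simp: lessThan_empty_iff)
  also have "\<dots> = distr (measure_pmf (pmf_of_set {..<N})) borel ?f"
    unfolding map_pmf_rep_eq by (subst distr_distr) (auto simp: o_def)
  finally show ?thesis .
qed

context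
  fixes A :: "real mat" and N :: nat and d :: "nat \<Rightarrow> real"
  assumes N: "0 < N" and d: "proots (char_poly A) = image_mset d (mset_set {..<N})"
begin

lemma integrable_empirical_power: "integrable (empirical_spectral_measure N A) (\<lambda>x. x ^ n)"
proof -
  have "finite (set_pmf (pmf_of_set {..<N}))" using N by (subst set_pmf_of_set) auto
  then show ?thesis
    unfolding empirical_eq_distr[OF N d]
    by (subst integrable_distr_eq) (auto intro: integrable_measure_pmf_finite)
qed

lemma integral_empirical_power:
  "(\<integral>x. x ^ n \<partial>empirical_spectral_measure N A) = (\<Sum>i<N. d i ^ n) / (real N * sqrt N ^ n)"
proof -
  have "(\<integral>x. x ^ n \<partial>empirical_spectral_measure N A) = (\<Sum>i<N. (d i / sqrt N) ^ n) / N"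
    unfolding empirical_eq_distr[OF N d] using N
    by (subst integral_distr, simp, simp, subst integral_pmf_of_set) auto
  then show ?thesis by (simp add: power_divide sum_divide_distrib mult.commute)
qed

lemma cdf_empirical:
  "cdf (empirical_spectral_measure N A) x = card {i\<in>{..<N}. d i \<le> x * sqrt N} / N"
proof -
  have "cdf (empirical_spectral_measure N A) x = measure (measure_pmf (pmf_of_set {..<N})) {i. d i / sqrt N \<le> x}"
    unfolding empirical_eq_distr[OF N d] cdf_def
    by (subst measure_distr) (auto simp: vimage_def)
  also have "\<dots> = card ({..<N} \<inter> {i. d i / sqrt N \<le> x}) / N"
    using N by (subst measure_pmf_of_set) auto
  also have "{..<N} \<inter> {i. d i / sqrt N \<le> x} = {i\<in>{..<N}. d i \<le> x * sqrt N}"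
    using N by (auto simp: field_simps)
  finally show ?thesis .
qed

end

section \<open>Removing the weights, and the limit law\<close>

lemma checkerboard_symmetric: "transpose_mat (checkerboard_matrix k W N a) = checkerboard_matrix k W N a"
  by (rule eq_matI) (auto simp: checkerboard_matrix_def min.commute max.commute)

lemma checkerboard_carrier: "checkerboard_matrix k W N a \<in> carrier_mat N N"
  by (simp add: checkerboard_matrix_def)

lemma checkerboard_spectral:
  obtains U d where "U \<in> carrier_mat N N" "transpose_mat U * U = 1\<^sub>m N"
    "checkerboard_matrix k W N a = U * mat_diag N d * transpose_mat U"
  using real_symmetric_spectral[OF checkerboard_carrier checkerboard_symmetric] by blast

text \<open>The weights contribute the sum over \<open>u < k\<close> of \<open>W u\<close> times the
  outer product of \<open>class_vector k N u\<close> with itself; this is the source of the rank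
  bound \<open>k\<close>.\<close>

definition class_vector :: "nat \<Rightarrow> nat \<Rightarrow> nat \<Rightarrow> real vec" where
  "class_vector k N u = vec N (\<lambda>i. if i mod k = u then 1 else 0)"

lemma checkerboard_mult_vec:
  assumes "1 \<le> k" "x \<in> carrier_vec N" "\<And>u. u < k \<Longrightarrow> class_vector k N u \<bullet> x = 0"
  shows "checkerboard_matrix k W N a *\<^sub>v x = checkerboard_matrix k (\<lambda>_. 0) N a *\<^sub>v x"
proof (rule eq_vecI)
  fix i assume "i < dim_vec (checkerboard_matrix k (\<lambda>_. 0) N a *\<^sub>v x)"
  then have i: "i < N" by (simp add: checkerboard_matrix_def)
  have "class_vector k N (i mod k) \<bullet> x = (\<Sum>j<N. (if j mod k = i mod k then 1 else 0) * x $ j)"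
    using assms(2) by (simp add: scalar_prod_def class_vector_def lessThan_atLeast0)
  then have zero: "(\<Sum>j<N. (if j mod k = i mod k then 1 else 0) * x $ j) = 0"
    using assms(1) assms(3)[of "i mod k"] by simp
  have "(checkerboard_matrix k W N a *\<^sub>v x) $ i = (\<Sum>j<N. checkerboard_matrix k W N a $$ (i, j) * x $ j)"
    using checkerboard_carrier assms(2) i by (rule mult_mat_vec_sum)
  also have "\<dots> = (\<Sum>j<N. checkerboard_matrix k (\<lambda>_. 0) N a $$ (i, j) * x $ j
      + W (i mod k) * ((if j mod k = i mod k then 1 else 0) * x $ j))"
    using i by (intro sum.cong refl) (auto simp: checkerboard_matrix_def)
  also have "\<dots> = (\<Sum>j<N. checkerboard_matrix k (\<lambda>_. 0) N a $$ (i, j) * x $ j)"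
    unfolding sum.distrib sum_distrib_left[symmetric] zero by simp
  also have "\<dots> = (checkerboard_matrix k (\<lambda>_. 0) N a *\<^sub>v x) $ i"
    using checkerboard_carrier assms(2) i by (rule mult_mat_vec_sum[symmetric])
  finally show "(checkerboard_matrix k W N a *\<^sub>v x) $ i = (checkerboard_matrix k (\<lambda>_. 0) N a *\<^sub>v x) $ i" .
qed (simp add: checkerboard_matrix_def)

lemma cdf_checkerboard_diff_le:
  assumes "1 \<le> k" "0 < N"
  shows "\<bar>cdf (empirical_spectral_measure N (checkerboard_matrix k W N a)) x
     - cdf (empirical_spectral_measure N (checkerboard_matrix k (\<lambda>_. 0) N a)) x\<bar> \<le> k / N"
proof -
  let ?A = "checkerboard_matrix k W N a" and ?B = "checkerboard_matrix k (\<lambda>_. 0) N a"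
  let ?K = "class_vector k N ` {..<k}"
  obtain U d where U: "U \<in> carrier_mat N N" "transpose_mat U * U = 1\<^sub>m N" "?A = U * mat_diag N d * transpose_mat U"
    by (rule checkerboard_spectral)
  obtain V f where V: "V \<in> carrier_mat N N" "transpose_mat V * V = 1\<^sub>m N" "?B = V * mat_diag N f * transpose_mat V"
    by (rule checkerboard_spectral)
  have K: "finite ?K" "?K \<subseteq> carrier_vec N" "card ?K \<le> k"
  proof -
    show "?K \<subseteq> carrier_vec N" by (rule image_subsetI) (simp add: class_vector_def)
    show "card ?K \<le> k" using card_image_le[of "{..<k}" "class_vector k N"] by simp
  qed simp
  have eq: "y \<bullet> (?A *\<^sub>v y) = y \<bullet> (?B *\<^sub>v y)" if "y \<in> carrier_vec N" "\<And>s. s \<in> ?K \<Longrightarrow> s \<bullet> y = 0" for y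
  proof -
    have "?A *\<^sub>v y = ?B *\<^sub>v y"
      by (rule checkerboard_mult_vec[OF assms(1) that(1)], rule that(2)) simp
    then show ?thesis by simp
  qed
  have "card {i\<in>{..<N}. d i \<le> x * sqrt N} \<le> card {i\<in>{..<N}. f i \<le> x * sqrt N} + card ?K"
    by (rule card_eigenvalues_le[OF U V K(1,2) eq])
  \<comment> \<open>The comparison of eigenvalue counts is one-sided; exchanging the two matrices
    supplies the other half of the absolute value.\<close>
  moreover have "card {i\<in>{..<N}. f i \<le> x * sqrt N} \<le> card {i\<in>{..<N}. d i \<le> x * sqrt N} + card ?K"
    by (rule card_eigenvalues_le[OF V U K(1,2) eq[symmetric]])
  ultimately have "\<bar>real (card {i\<in>{..<N}. d i \<le> x * sqrt N}) - card {i\<in>{..<N}. f i \<le> x * sqrt N}\<bar> \<le> k"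
    using K(3) by linarith
  then show ?thesis
    unfolding cdf_empirical[OF assms(2) spectral_proots[OF U]] cdf_empirical[OF assms(2) spectral_proots[OF V]]
    by (simp add: diff_divide_distrib[symmetric] divide_right_mono)
qed

lemma weak_conv_m_perturb:
  assumes "weak_conv_m \<nu> \<sigma>"
    and "\<And>N x. 0 < N \<Longrightarrow> \<bar>cdf (\<nu>' N) x - cdf (\<nu> N) x\<bar> \<le> c / real N"
  shows "weak_conv_m \<nu>' \<sigma>"
  unfolding weak_conv_m_def weak_conv_def
proof (intro allI impI)
  fix x assume "isCont (cdf \<sigma>) x"
  then have 1: "(\<lambda>N. cdf (\<nu> N) x) \<longlonglongrightarrow> cdf \<sigma> x"
    using assms(1) by (simp add: weak_conv_m_def weak_conv_def)
  have "(\<lambda>N. cdf (\<nu>' N) x - cdf (\<nu> N) x) \<longlonglongrightarrow> 0"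
  proof (rule Lim_null_comparison)
    show "\<forall>\<^sub>F N in sequentially. norm (cdf (\<nu>' N) x - cdf (\<nu> N) x) \<le> c / real N"
      using eventually_gt_at_top[of 0] by eventually_elim (simp add: assms(2))
    show "(\<lambda>N. c / real N) \<longlonglongrightarrow> 0" by (rule lim_const_over_n)
  qed
  from tendsto_add[OF this 1] show "(\<lambda>N. cdf (\<nu>' N) x) \<longlonglongrightarrow> cdf \<sigma> x" by simp
qed

lemma (in checkerboard_entries) AE_weak_conv_checkerboard_0:
  "AE \<omega> in M. weak_conv_m
     (\<lambda>N. empirical_spectral_measure N (checkerboard_matrix k (\<lambda>_. 0) N (\<lambda>i j. X N i j \<omega>)))
     (semicircle_measure (2 * sqrt (1 - 1 / real k)))"
proof -
  define R where "R = 2 * sqrt (1 - 1 / real k)"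
  have R: "0 \<le> R" using k by (simp add: R_def)
  \<comment> \<open>For odd \<open>n\<close> the two powers differ, but
    \<open>dyck_count n 0\<close> is 0.\<close>
  have moment_limit: "(R / 2) ^ n * dyck_count n 0 = (1 - 1 / real k) ^ (n div 2) * dyck_count n 0" for n
  proof (cases "even n")
    case True
    have "sqrt (1 - 1 / real k) ^ n = (sqrt (1 - 1 / real k))\<^sup>2 ^ (n div 2)"
      using True by (metis dvd_mult_div_cancel power_mult)
    then show ?thesis using k by (simp add: R_def)
  qed (simp add: dyck_count_odd)
  \<comment> \<open>There are countably many moments, so one null set serves all of them.\<close>
  have "AE \<omega> in M. \<forall>n. (\<lambda>N. walk_sum n N \<omega> / (real N * sqrt N ^ n))
     \<longlonglongrightarrow> (1 - 1 / real k) ^ (n div 2) * dyck_count n 0"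
    unfolding AE_all_countable using AE_walk_sum_limit by blast
  then show ?thesis
    unfolding R_def[symmetric]
  proof eventually_elim
    case (elim \<omega>)
    let ?A = "\<lambda>N. checkerboard_matrix k (\<lambda>_. 0) N (\<lambda>i j. X N i j \<omega>)"
    have ints: "integrable (empirical_spectral_measure N (?A N)) (\<lambda>x. x ^ n)"
      "(\<integral>x. x ^ n \<partial>empirical_spectral_measure N (?A N)) = walk_sum n N \<omega> / (real N * sqrt N ^ n)"
      if N: "0 < N" for N n
    proof -
      obtain U d where U: "U \<in> carrier_mat N N" "transpose_mat U * U = 1\<^sub>m N" "?A N = U * mat_diag N d * transpose_mat U"
        by (rule checkerboard_spectral)
      note d = spectral_proots[OF U]
      show "integrable (empirical_spectral_measure N (?A N)) (\<lambda>x. x ^ n)"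
        using N d by (rule integrable_empirical_power)
      have A: "?A N = mat N N (\<lambda>(i, j). if i mod k = j mod k then 0 else (\<lambda>(i, j). X N i j \<omega>) (edge i j))"
        by (rule eq_matI) (auto simp: checkerboard_matrix_def edge_def)
      show "(\<integral>x. x ^ n \<partial>empirical_spectral_measure N (?A N)) = walk_sum n N \<omega> / (real N * sqrt N ^ n)"
        unfolding integral_empirical_power[OF N d] spectral_power_sum[OF U] trace_pow_mat_eq_sum_walks[OF A]
        by (simp add: walk_sum_def walk_product_def)
    qed
    show ?case
    proof (rule weak_conv_m_of_moments)
      show "real_distribution (semicircle_measure R)" by (rule real_distribution_semicircle[OF R])
      show "integrable (semicircle_measure R) (\<lambda>x. x ^ n)" for n
        by (rule integrable_semicircle_power[OF R])
      show "(\<lambda>N. \<integral>x. x ^ n \<partial>empirical_spectral_measure N (?A N)) \<longlonglongrightarrow> (\<integral>x. x ^ n \<partial>semicircle_measure R)" for n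
      proof (rule Lim_transform_eventually)
        show "(\<lambda>N. walk_sum n N \<omega> / (real N * sqrt N ^ n)) \<longlonglongrightarrow> (\<integral>x. x ^ n \<partial>semicircle_measure R)"
          unfolding integral_semicircle_power[OF R] moment_limit using elim by blast
        show "\<forall>\<^sub>F N in sequentially. walk_sum n N \<omega> / (real N * sqrt N ^ n) = (\<integral>x. x ^ n \<partial>empirical_spectral_measure N (?A N))"
          using eventually_gt_at_top[of 0] by eventually_elim (simp add: ints(2))
      qed
      show "(\<integral>x. x ^ n \<partial>semicircle_measure R) \<le> R ^ n" for n
      proof -
        \<comment> \<open>At most two choices per step; the factor \<open>2 ^ n\<close> turns
          \<open>R / 2\<close> into the growth rate \<open>R\<close> that controls the Taylor
          remainder.\<close>
        have "real (dyck_count n 0) \<le> 2 ^ n" using dyck_count_le[of n 0] by (metis of_nat_le_iff of_nat_numeral of_nat_power)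
        then have "(R / 2) ^ n * dyck_count n 0 \<le> (R / 2) ^ n * 2 ^ n" using R by (intro mult_left_mono) auto
        also have "\<dots> = R ^ n" by (simp flip: power_mult_distrib)
        finally show ?thesis unfolding integral_semicircle_power[OF R] .
      qed
    qed (use ints(1) real_distribution_empirical in auto)
  qed
qed

theorem theorem1p3:
  fixes M :: "'a measure"
    and k :: nat
    and W :: "nat \<Rightarrow> real"
    and X :: "nat \<Rightarrow> nat \<Rightarrow> nat \<Rightarrow> 'a \<Rightarrow> real"
  defines "I \<equiv> {(N, i, j). i < j \<and> j < N \<and> i mod k \<noteq> j mod k}"
  assumes "prob_space M"
    and "k \<ge> 1"
    and indep: "prob_space.indep_vars M (\<lambda>_. borel) (\<lambda>(N, i, j). X N i j) I"
    and ident: "\<forall>s\<in>I. \<forall>t\<in>I. distr M borel (case s of (N, i, j) \<Rightarrow> X N i j)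
                                 = distr M borel (case t of (N, i, j) \<Rightarrow> X N i j)"
    and moments: "\<forall>(N, i, j)\<in>I. \<forall>n::nat. integrable M (\<lambda>\<omega>. X N i j \<omega> ^ n)"
    and mean: "\<forall>(N, i, j)\<in>I. prob_space.expectation M (X N i j) = 0"
    and var: "\<forall>(N, i, j)\<in>I. prob_space.expectation M (\<lambda>\<omega>. (X N i j \<omega>)\<^sup>2) = 1"
  shows "AE \<omega> in M. weak_conv_m
           (\<lambda>N. empirical_spectral_measure N
                   (checkerboard_matrix k W N (\<lambda>i j. X N i j \<omega>)))
           (semicircle_measure (2 * sqrt (1 - 1 / real k)))"
proof -
  interpret prob_space M by fact
  have "\<exists>\<mu>. \<mu> 1 = 0 \<and> \<mu> 2 = 1 \<and> (\<forall>(N, i, j)\<in>I. \<forall>m. expectation (\<lambda>\<omega>. X N i j \<omega> ^ m) = \<mu> m)"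
  proof (cases "I = {}")
    case True
    \<comment> \<open>This is the case \<open>k = 1\<close>, where there are no random entries and
      the required values of \<open>\<mu>\<close> are simply prescribed.\<close>
    then show ?thesis by (intro exI[of _ "\<lambda>m. if m = 2 then 1 else 0"]) auto
  next
    case False
    then obtain N0 i0 j0 where t0: "(N0, i0, j0) \<in> I" by auto
    have rv: "X N i j \<in> borel_measurable M" if "(N, i, j) \<in> I" for N i j
    proof -
      have "\<forall>t\<in>I. (\<lambda>(N, i, j). X N i j) t \<in> borel_measurable M"
        using indep unfolding indep_vars_def2 by (rule conjunct1)
      from bspec[OF this that] show ?thesis by simp
    qed
    have "expectation (\<lambda>\<omega>. X N i j \<omega> ^ m) = expectation (\<lambda>\<omega>. X N0 i0 j0 \<omega> ^ m)"
      if "(N, i, j) \<in> I" for N i j m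
    proof -
      have eq: "distr M borel (X N i j) = distr M borel (X N0 i0 j0)"
        using bspec[OF bspec[OF ident that] t0] by simp
      have "expectation (\<lambda>\<omega>. X N i j \<omega> ^ m) = (\<integral>x. x ^ m \<partial>distr M borel (X N i j))"
        using rv[OF that] by (subst integral_distr) auto
      also have "\<dots> = expectation (\<lambda>\<omega>. X N0 i0 j0 \<omega> ^ m)"
        unfolding eq using rv[OF t0] by (subst integral_distr) auto
      finally show ?thesis .
    qed
    moreover have "expectation (X N0 i0 j0) = 0" "expectation (\<lambda>\<omega>. (X N0 i0 j0 \<omega>)\<^sup>2) = 1"
      using bspec[OF mean t0] bspec[OF var t0] by simp_all
    ultimately show ?thesis
      by (intro exI[of _ "\<lambda>m. expectation (\<lambda>\<omega>. X N0 i0 j0 \<omega> ^ m)"]) auto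
  qed
  then obtain \<mu> where \<mu>: "\<mu> 1 = 0" "\<mu> 2 = 1"
      "\<And>N i j m. (N, i, j) \<in> I \<Longrightarrow> expectation (\<lambda>\<omega>. X N i j \<omega> ^ m) = \<mu> m" by blast
  interpret checkerboard_entries M k X \<mu>
  proof unfold_locales
    show "indep_vars (\<lambda>_. borel) (\<lambda>(N, i, j). X N i j) {(N, i, j). i < j \<and> j < N \<and> i mod k \<noteq> j mod k}"
      using indep unfolding I_def .
    show "integrable M (\<lambda>\<omega>. X N i j \<omega> ^ m)" if "i < j" "j < N" "i mod k \<noteq> j mod k" for N i j m
      using bspec[OF moments, of "(N, i, j)"] that by (simp add: I_def)
    show "expectation (\<lambda>\<omega>. X N i j \<omega> ^ m) = \<mu> m" if "i < j" "j < N" "i mod k \<noteq> j mod k" for N i j m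
      using that by (intro \<mu>) (simp add: I_def)
  qed (use \<mu> \<open>k \<ge> 1\<close> in auto)
  \<comment> \<open>The comparison with the weighted matrix holds for every outcome, so the
    exceptional null set stays the same.\<close>
  from AE_weak_conv_checkerboard_0 show ?thesis
  proof eventually_elim
    case (elim \<omega>)
    then show ?case
      by (rule weak_conv_m_perturb) (rule cdf_checkerboard_diff_le[OF k])
  qed
qed

end
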